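(* Let $M$ be a linear $\lambda$-term. If $\Gamma\vdash M:\sigma$ and $M\to_\beta^* N$, then $\Gamma\vdash N:\sigma$.
   Context: Types: $\sigma ::= \varphi \mid \sigma\to\sigma \mid \sigma\wedge\sigma \mid \sigma\vee\sigma$ ($\varphi$ atomic). A $\lambda$-term is linear if each free or bound variable occurs exactly once in it. Environments are finite sets of assumptions $x:\sigma$ with distinct variables; $\Gamma_1,\Gamma_2$ denotes union of environments with disjoint variables. Rules: (Ax) $x:\sigma\vdash x:\sigma$; ($\to$I) from $\Gamma,x:\sigma\vdash M:\tau$ infer $\Gamma\vdash\lambda x.M:\sigma\to\tau$; ($\to$E) from $\Gamma_1\vdash M:\sigma\to\tau$ and $\Gamma_2\vdash N:\sigma$ infer $\Gamma_1,\Gamma_2\vdash MN:\tau$; ($\wedge$I) from $\Gamma\vdash M:\sigma$ and $\Gamma\vdash M:\tau$ infer $\Gamma\vdash M:\sigma\wedge\tau$; ($\wedge$E) from $\Gamma\vdash M:\sigma\wedge\tau$ infer $\Gamma\vdash M:\sigma$ and $\Gamma\vdash M:\tau$; ($\vee$I) from $\Gamma\vdash M:\sigma$ infer $\Gamma\vdash M:\sigma\vee\tau$ and $\Gamma\vdash M:\tau\vee\sigma$; ($\vee$E) from $\Gamma_1,x:\sigma\wedge\theta\vdash M:\rho$, $\Gamma_1,x:\tau\wedge\theta\vdash M:\rho$ and $\Gamma_2\vdash N:(\sigma\vee\tau)\wedge\theta$ infer $\Gamma_1,\Gamma_2\vdash M[N/x]:\rho$. *)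

theory Defs
  imports Main
begin

datatype 'a ty =
    Atom 'a
  | Arrow "'a ty" "'a ty"  (infixr "\<^bold>\<rightarrow>" 60)
  | Inter "'a ty" "'a ty"  (infixr "\<^bold>\<and>" 70)
  | Union "'a ty" "'a ty"  (infixr "\<^bold>\<or>" 65)

type_synonym name = nat

text \<open>
  Lambda-terms up to alpha-equivalence, in locally nameless form: free variables are names, bound
  variables are de Bruijn indices. The raw type also contains junk with dangling indices; the
  lambda-terms are the elements of the predicate \<open>lterm\<close> below, which is generated by the named
  constructors \<open>FVar x\<close>, \<open>App M N\<close> and \<open>Lam x M\<close>.
\<close>

datatype trm =
    FVar name
  | BVar nat
  | App trm trm
  | Abs trm

primrec close :: "nat \<Rightarrow> name \<Rightarrow> trm \<Rightarrow> trm" where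
  "close k x (FVar y) = (if x = y then BVar k else FVar y)"
| "close k x (BVar i) = BVar i"
| "close k x (App M N) = App (close k x M) (close k x N)"
| "close k x (Abs M) = Abs (close (Suc k) x M)"

definition Lam :: "name \<Rightarrow> trm \<Rightarrow> trm" where
  "Lam x M = Abs (close 0 x M)"

inductive lterm :: "trm \<Rightarrow> bool" where
  "lterm (FVar x)"
| "lterm M \<Longrightarrow> lterm N \<Longrightarrow> lterm (App M N)"
| "lterm M \<Longrightarrow> lterm (Lam x M)"

primrec fv :: "trm \<Rightarrow> name set" where
  "fv (FVar x) = {x}"
| "fv (BVar i) = {}"
| "fv (App M N) = fv M \<union> fv N"
| "fv (Abs M) = fv M"

text \<open>
  \<open>M[x ::= N]\<close> is capture-avoiding because a lambda-term \<open>N\<close> has no dangling index.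
\<close>

primrec subst :: "trm \<Rightarrow> name \<Rightarrow> trm \<Rightarrow> trm"  ("_[_ ::= _]" [1000, 0, 0] 1000) where
  "(FVar y)[x ::= N] = (if x = y then N else FVar y)"
| "(BVar i)[x ::= N] = BVar i"
| "(App M P)[x ::= N] = App (M[x ::= N]) (P[x ::= N])"
| "(Abs M)[x ::= N] = Abs (M[x ::= N])"

lemma close_rename:
  "y \<notin> fv M \<Longrightarrow> close k y (M[x ::= FVar y]) = close k x M"
  by (induction M arbitrary: k) auto

lemma Lam_alpha: "y \<notin> fv M \<Longrightarrow> Lam y (M[x ::= FVar y]) = Lam x M"
  by (simp add: Lam_def close_rename)

lemma Lam_subst:
  assumes "y \<noteq> x" "y \<notin> fv N"
  shows "(Lam y M)[x ::= N] = Lam y (M[x ::= N])"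
proof -
  have N: "close k y N = N" for k
    using assms(2) by (induction N arbitrary: k) auto
  have "(close k y M)[x ::= N] = close k y (M[x ::= N])" for k
    using assms(1) N by (induction M arbitrary: k) auto
  then show ?thesis
    by (simp add: Lam_def)
qed

primrec occs :: "name \<Rightarrow> trm \<Rightarrow> nat" where
  "occs x (FVar y) = (if x = y then 1 else 0)"
| "occs x (BVar i) = 0"
| "occs x (App M N) = occs x M + occs x N"
| "occs x (Abs M) = occs x M"

text \<open>
  Lambda-terms in which every bound variable occurs exactly once (in the scope of its binder).
\<close>

inductive bound_once :: "trm \<Rightarrow> bool" where
  "bound_once (FVar x)"
| "bound_once M \<Longrightarrow> bound_once N \<Longrightarrow> bound_once (App M N)"
| "bound_once M \<Longrightarrow> occs x M = 1 \<Longrightarrow> bound_once (Lam x M)"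

definition linear_lterm :: "trm \<Rightarrow> bool" where
  "linear_lterm M \<longleftrightarrow> lterm M \<and> bound_once M \<and> (\<forall>x \<in> fv M. occs x M = 1)"

text \<open>
  The \<open>lterm\<close> premises restrict reduction to lambda-terms; without them a dangling index in the
  body \<open>M\<close> would be captured by \<open>Lam x M\<close>.
\<close>

inductive beta :: "trm \<Rightarrow> trm \<Rightarrow> bool"  (infix "\<rightarrow>\<^sub>\<beta>" 50) where
  beta: "lterm M \<Longrightarrow> lterm N \<Longrightarrow> App (Lam x M) N \<rightarrow>\<^sub>\<beta> M[x ::= N]"
| appL: "M \<rightarrow>\<^sub>\<beta> M' \<Longrightarrow> lterm N \<Longrightarrow> App M N \<rightarrow>\<^sub>\<beta> App M' N"
| appR: "lterm M \<Longrightarrow> N \<rightarrow>\<^sub>\<beta> N' \<Longrightarrow> App M N \<rightarrow>\<^sub>\<beta> App M N'"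
| xi: "M \<rightarrow>\<^sub>\<beta> M' \<Longrightarrow> Lam x M \<rightarrow>\<^sub>\<beta> Lam x M'"

abbreviation betas :: "trm \<Rightarrow> trm \<Rightarrow> bool"  (infix "\<rightarrow>\<^sub>\<beta>\<^sup>*" 50) where
  "M \<rightarrow>\<^sub>\<beta>\<^sup>* N \<equiv> beta\<^sup>*\<^sup>* M N"

text \<open>
  An environment is a finite set of assumptions with distinct variables, i.e. a finite partial map.
  Finiteness need not be imposed: it holds in every derivable judgement (\<open>typing_finite\<close>).
\<close>

type_synonym 'a env = "name \<rightharpoonup> 'a ty"

inductive typing :: "'a env \<Rightarrow> trm \<Rightarrow> 'a ty \<Rightarrow> bool"  ("_ \<turnstile> _ \<^bold>: _" [50, 50, 50] 50) where
  Ax: "[x \<mapsto> \<sigma>] \<turnstile> FVar x \<^bold>: \<sigma>"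
| ArrI: "\<Gamma> x = None \<Longrightarrow> \<Gamma>(x \<mapsto> \<sigma>) \<turnstile> M \<^bold>: \<tau> \<Longrightarrow> \<Gamma> \<turnstile> Lam x M \<^bold>: \<sigma> \<^bold>\<rightarrow> \<tau>"
| ArrE: "dom \<Gamma>\<^sub>1 \<inter> dom \<Gamma>\<^sub>2 = {} \<Longrightarrow> \<Gamma>\<^sub>1 \<turnstile> M \<^bold>: \<sigma> \<^bold>\<rightarrow> \<tau> \<Longrightarrow> \<Gamma>\<^sub>2 \<turnstile> N \<^bold>: \<sigma> \<Longrightarrow>
    \<Gamma>\<^sub>1 ++ \<Gamma>\<^sub>2 \<turnstile> App M N \<^bold>: \<tau>"
| InterI: "\<Gamma> \<turnstile> M \<^bold>: \<sigma> \<Longrightarrow> \<Gamma> \<turnstile> M \<^bold>: \<tau> \<Longrightarrow> \<Gamma> \<turnstile> M \<^bold>: \<sigma> \<^bold>\<and> \<tau>"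
| InterE1: "\<Gamma> \<turnstile> M \<^bold>: \<sigma> \<^bold>\<and> \<tau> \<Longrightarrow> \<Gamma> \<turnstile> M \<^bold>: \<sigma>"
| InterE2: "\<Gamma> \<turnstile> M \<^bold>: \<sigma> \<^bold>\<and> \<tau> \<Longrightarrow> \<Gamma> \<turnstile> M \<^bold>: \<tau>"
| UnionI1: "\<Gamma> \<turnstile> M \<^bold>: \<sigma> \<Longrightarrow> \<Gamma> \<turnstile> M \<^bold>: \<sigma> \<^bold>\<or> \<tau>"
| UnionI2: "\<Gamma> \<turnstile> M \<^bold>: \<sigma> \<Longrightarrow> \<Gamma> \<turnstile> M \<^bold>: \<tau> \<^bold>\<or> \<sigma>"
| UnionE: "dom \<Gamma>\<^sub>1 \<inter> dom \<Gamma>\<^sub>2 = {} \<Longrightarrow> \<Gamma>\<^sub>1 x = None \<Longrightarrow>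
    \<Gamma>\<^sub>1(x \<mapsto> \<sigma> \<^bold>\<and> \<theta>) \<turnstile> M \<^bold>: \<rho> \<Longrightarrow> \<Gamma>\<^sub>1(x \<mapsto> \<tau> \<^bold>\<and> \<theta>) \<turnstile> M \<^bold>: \<rho> \<Longrightarrow>
    \<Gamma>\<^sub>2 \<turnstile> N \<^bold>: (\<sigma> \<^bold>\<or> \<tau>) \<^bold>\<and> \<theta> \<Longrightarrow>
    \<Gamma>\<^sub>1 ++ \<Gamma>\<^sub>2 \<turnstile> M[x ::= N] \<^bold>: \<rho>"

lemma typing_finite: "\<Gamma> \<turnstile> M \<^bold>: \<sigma> \<Longrightarrow> finite (dom \<Gamma>)"
  by (induction rule: typing.induct) (auto simp del: fun_upd_apply)

end

(*
  The substitution of an abstraction by the union elimination rule may create redexes, so the point is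
  to show that case distinctions on the type of an abstraction can be avoided. Linearity gives an
  interpolation property: a typing of M[N/z] splits into N : t and z : t |- M : r for some t. Hence
  two typings of an abstraction whose derivations make different case distinctions can be merged, and
  every typing of an abstraction consists of case distinctions on subterms that are not abstractions,
  followed by introduction rules only. Below the case distinctions, a union type of an abstraction is
  the union of two types one of which it has, and an arrow type comes from a typing of its body.
  Contracting a redex then reduces to substitution in the body, and interpolation isolates the
  function and the argument of an application.
*)

theory Submission
  imports Defs "HOL-Combinatorics.Transposition"
begin

section \<open>Terms\<close>

text \<open>\<open>UnionE\<close> speaks of a substitution, so a derivation need not follow the
  shape of its term, and inversion for applications and abstractions fails. If \<open>x\<close>
  could occur several times in \<open>M\<close>, a step might contract just one copy of
  \<open>N\<close> in \<open>M[x ::= N]\<close>, and the rule could not be replayed. With one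
  occurrence a step concerns \<open>M\<close> or \<open>N\<close> alone, unless it contracts a redex
  created by an abstraction \<open>N\<close>; that exception is what mode \<open>Val\<close>
  excludes. Interpolants exist because types have both connectives: if \<open>N\<close> contains the
  term on which cases are distinguished, the interpolants of the branches are joined by a union;
  where two interpolants are types of the same \<open>N\<close>, they are intersected. The component
  \<theta> of \<open>UnionE\<close> leaves room for an interpolant, so a case distinction of one
  derivation can be replayed in another. No order on types is introduced: a typing of a variable,
  from its assumed type to another one, serves as subtyping.\<close>

lemma subst_fresh: "x \<notin> fv M \<Longrightarrow> M[x ::= N] = M"
  by (induction M) auto

lemma subst_self [simp]: "M[x ::= FVar x] = M"
  by (induction M) auto

lemma fv_subst: "x \<in> fv M \<Longrightarrow> fv (M[x ::= N]) = fv M - {x} \<union> fv N"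
proof (induction M)
  case (App M1 M2)
  then show ?case
    by (cases "x \<in> fv M1"; cases "x \<in> fv M2") (auto simp: subst_fresh)
qed auto

lemma fv_subst_subset: "fv (M[x ::= N]) \<subseteq> fv M - {x} \<union> fv N"
  by (induction M) auto

lemma subst_compose: "y \<notin> fv M \<Longrightarrow> M[x ::= N][y ::= L] = M[x ::= N[y ::= L]]"
  by (induction M) auto

lemma subst_subst:
  "x \<noteq> y \<Longrightarrow> x \<notin> fv L \<Longrightarrow> M[x ::= N][y ::= L] = M[y ::= L][x ::= N[y ::= L]]"
  by (induction M) (auto simp: subst_fresh)

lemma size_subst: "size M \<le> size (M[x ::= N])"
  by (induction M) auto

lemma size_subst_ge: "x \<in> fv M \<Longrightarrow> size N \<le> size (M[x ::= N])"
  by (induction M) auto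

lemma fv_close [simp]: "fv (close k x M) = fv M - {x}"
  by (induction M arbitrary: k) auto

lemma fv_Lam [simp]: "fv (Lam x M) = fv M - {x}"
  by (simp add: Lam_def)

lemma finite_fv [simp]: "finite (fv M)"
  by (induction M) auto

lemma ex_fresh: "finite (S :: name set) \<Longrightarrow> \<exists>x. x \<notin> S"
  using ex_new_if_finite infinite_UNIV_nat by blast

lemma occs_fresh: "occs x M = 0 \<longleftrightarrow> x \<notin> fv M"
  by (induction M) auto

lemma occs_close [simp]: "occs y (close k x M) = (if x = y then 0 else occs y M)"
  by (induction M arbitrary: k) auto

lemma occs_subst:
  "occs y (M[x ::= N]) = (if x = y then 0 else occs y M) + occs x M * occs y N"
  by (induction M) (auto simp: algebra_simps)

lemma Lam_not [simp]: "Lam x M \<noteq> FVar y" "Lam x M \<noteq> App P Q" "FVar y \<noteq> Lam x M" "App P Q \<noteq> Lam x M"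
  by (auto simp: Lam_def)

definition is_Abs :: "trm \<Rightarrow> bool" where
  "is_Abs M \<longleftrightarrow> (\<exists>P. M = Abs P)"

lemma is_Abs_simps [simp]:
  "is_Abs (Lam x M)" "is_Abs (Abs P)" "\<not> is_Abs (FVar y)" "\<not> is_Abs (App M N)" "\<not> is_Abs (BVar i)"
  by (auto simp: is_Abs_def Lam_def)

lemma is_Abs_subst: "is_Abs (M[x ::= N]) \<longleftrightarrow> is_Abs M \<or> M = FVar x \<and> is_Abs N"
  by (cases M) auto

text \<open>Inductions on raw terms pass under \<open>Abs\<close>, where \<open>lterm\<close> is
  lost; the bound \<open>k\<close> on dangling indices keeps the information.\<close>

primrec lc :: "nat \<Rightarrow> trm \<Rightarrow> bool" where
  "lc k (FVar x) \<longleftrightarrow> True"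
| "lc k (BVar i) \<longleftrightarrow> i < k"
| "lc k (App M N) \<longleftrightarrow> lc k M \<and> lc k N"
| "lc k (Abs M) \<longleftrightarrow> lc (Suc k) M"

lemma lc_close: "lc k M \<Longrightarrow> lc (Suc k) (close k x M)"
  by (induction M arbitrary: k) auto

lemma lc_mono: "lc k M \<Longrightarrow> k \<le> l \<Longrightarrow> lc l M"
  by (induction M arbitrary: k l) auto

text \<open>Turning the index \<open>k\<close> into a name undoes \<open>close\<close>; freshness of
  \<open>x\<close> keeps other names from becoming indices. Equal sizes permit size induction, since
  the named body is not a subterm of the abstraction.\<close>

lemma ex_close:
  "lc (Suc k) M \<Longrightarrow> x \<notin> fv M \<Longrightarrow> \<exists>M'. close k x M' = M \<and> lc k M' \<and> size M' = size M"
proof (induction M arbitrary: k)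
  case (FVar y)
  then show ?case by (intro exI[of _ "FVar y"]) auto
next
  case (BVar i)
  then show ?case
    by (cases "i = k") (auto intro: exI[of _ "FVar x"] exI[of _ "BVar i"])
next
  case (App M N)
  then obtain M' N' where "close k x M' = M \<and> lc k M' \<and> size M' = size M"
    "close k x N' = N \<and> lc k N' \<and> size N' = size N"
    by (metis UnCI fv.simps(3) lc.simps(3))
  then show ?case by (intro exI[of _ "App M' N'"]) auto
next
  case (Abs M)
  then obtain M' where "close (Suc k) x M' = M \<and> lc (Suc k) M' \<and> size M' = size M"
    by (metis fv.simps(4) lc.simps(4))
  then show ?case by (intro exI[of _ "Abs M'"]) auto
qed

lemma lterm_iff_lc: "lterm M \<longleftrightarrow> lc 0 M"
proof
  show "lterm M \<Longrightarrow> lc 0 M"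
    by (induction rule: lterm.induct) (auto simp: Lam_def lc_close)
  show "lc 0 M \<Longrightarrow> lterm M"
  proof (induction M rule: measure_induct_rule[of size])
    case (less M)
    show ?case
    proof (cases M)
      case (Abs P)
      obtain x where "x \<notin> fv P" using ex_fresh finite_fv by blast
      with ex_close[of 0 P x] less.prems Abs obtain M'
        where "close 0 x M' = P" "lc 0 M'" "size M' = size P" by auto
      with less.IH[of M'] Abs show ?thesis
        by (auto simp: Lam_def intro: lterm.intros(3)[unfolded Lam_def])
    qed (use less in \<open>auto intro: lterm.intros\<close>)
  qed
qed

lemma lc_subst: "lc k M \<Longrightarrow> lc k N \<Longrightarrow> lc k (M[x ::= N])"
proof (induction M arbitrary: k)
  case (Abs M)
  then show ?case using lc_mono[of k N "Suc k"] by simp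
qed auto

lemma lc_substD: "lc k (M[x ::= N]) \<Longrightarrow> lc k M"
  by (induction M arbitrary: k) auto

lemma lterm_subst: "lterm M \<Longrightarrow> lterm N \<Longrightarrow> lterm (M[x ::= N])"
  by (simp add: lterm_iff_lc lc_subst)

lemma lterm_substD: "lterm (M[x ::= N]) \<Longrightarrow> lterm M"
  by (auto simp: lterm_iff_lc intro: lc_substD)

lemma lterm_App [simp]: "lterm (App M N) \<longleftrightarrow> lterm M \<and> lterm N"
  by (simp add: lterm_iff_lc)

lemma lterm_FVar [simp]: "lterm (FVar x)"
  by (simp add: lterm_iff_lc)

lemma Lam_cases_fresh:
  assumes "lterm (Abs P)" "x \<notin> fv P"
  obtains M where "Abs P = Lam x M" "lterm M" "size M = size P"
  using ex_close[of 0 P x] assms by (auto simp: Lam_def lterm_iff_lc)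

text \<open>Local closure excludes the only clash, between \<open>FVar x\<close> and
  \<open>BVar k\<close>.\<close>

lemma close_inj: "close k x M = close k x N \<Longrightarrow> lc k M \<Longrightarrow> lc k N \<Longrightarrow> M = N"
proof (induction M arbitrary: k N)
  case (FVar y)
  then show ?case by (cases N) (auto split: if_splits)
next
  case (BVar i)
  then show ?case by (cases N) (auto split: if_splits)
next
  case (App M1 M2)
  then show ?case by (cases N) (auto split: if_splits)
next
  case (Abs M)
  then show ?case by (cases N) (auto split: if_splits)
qed

lemma Lam_inject: "Lam x M = Lam x N \<Longrightarrow> lterm M \<Longrightarrow> lterm N \<Longrightarrow> M = N"
  by (auto simp: Lam_def lterm_iff_lc intro: close_inj)

text \<open>Capture-avoiding only when \<open>N\<close> has no dangling index.\<close>

primrec opn :: "nat \<Rightarrow> trm \<Rightarrow> trm \<Rightarrow> trm" where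
  "opn k N (FVar x) = FVar x"
| "opn k N (BVar i) = (if i = k then N else BVar i)"
| "opn k N (App P Q) = App (opn k N P) (opn k N Q)"
| "opn k N (Abs P) = Abs (opn (Suc k) N P)"

lemma opn_close: "lc k M \<Longrightarrow> opn k N (close k x M) = M[x ::= N]"
  by (induction M arbitrary: k) auto

lemma opn_fresh: "lc k M \<Longrightarrow> opn k N M = M"
  by (induction M arbitrary: k) auto

lemma opn_subst:
  "lterm B \<Longrightarrow> opn k (N[y ::= B]) (P[y ::= B]) = (opn k N P)[y ::= B]"
proof (induction P arbitrary: k)
  case (FVar x)
  then show ?case by (auto simp: lterm_iff_lc intro!: opn_fresh intro: lc_mono)
qed auto

lemma fv_opn_subset: "fv (opn k N P) \<subseteq> fv P \<union> fv N"
proof (induction P arbitrary: k)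
  case (App P Q)
  then show ?case by simp blast
qed auto

lemma fv_subset_opn: "fv P \<subseteq> fv (opn k N P)"
proof (induction P arbitrary: k)
  case (App P Q)
  then show ?case by simp blast
qed auto

text \<open>
  Two occurrences of subterms in the same term are nested, in one way or the other, or disjoint.
\<close>

lemma subst_eq_subst_cases:
  assumes "M[z ::= N] = A[x ::= B]" "occs z M = 1" "occs x A = 1"
    and "x \<notin> fv M" "z \<notin> fv A"
  obtains
    (outer) N' where "N = N'[x ::= B]" "A = M[z ::= N']" "x \<in> fv N'"
  | (inner) B' where "B = B'[z ::= N]" "M = A[x ::= B']" "occs z B' = 1"
  | (disjoint) C where "M = C[x ::= B]" "A = C[z ::= N]" "x \<in> fv C" "occs z C = 1"
proof -
  have "(\<exists>N'. N = N'[x ::= B] \<and> A = M[z ::= N'] \<and> x \<in> fv N') \<or>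
    (\<exists>B'. B = B'[z ::= N] \<and> M = A[x ::= B'] \<and> occs z B' = 1) \<or>
    (\<exists>C. M = C[x ::= B] \<and> A = C[z ::= N] \<and> x \<in> fv C \<and> occs z C = 1)"
    using assms
  proof (induction M arbitrary: A)
    case (FVar y)
    then show ?case by (auto split: if_splits simp flip: occs_fresh)
  next
    case (BVar i)
    from BVar.prems(2) show ?case by simp
  next
    case (App M1 M2)
    show ?case
    proof (cases A)
      case (FVar y)
      then show ?thesis using App.prems by (auto split: if_splits)
    next
      case (BVar i)
      then show ?thesis using App.prems by auto
    next
      case (Abs P)
      then show ?thesis using App.prems by auto
    next
      case A: (App A1 A2)
      have eq: "M1[z ::= N] = A1[x ::= B]" "M2[z ::= N] = A2[x ::= B]"
        using App.prems A by auto
      have fr: "x \<notin> fv M1" "x \<notin> fv M2" "z \<notin> fv A1" "z \<notin> fv A2"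
        using App.prems A by auto
      consider "occs z M1 = 1" "occs z M2 = 0" | "occs z M1 = 0" "occs z M2 = 1"
        using App.prems(2) by fastforce
      moreover consider "occs x A1 = 1" "occs x A2 = 0" | "occs x A1 = 0" "occs x A2 = 1"
        using App.prems(3) A by fastforce
      ultimately consider
        (LL) "occs z M1 = 1" "z \<notin> fv M2" "occs x A1 = 1" "x \<notin> fv A2"
        | (LR) "occs z M1 = 1" "z \<notin> fv M2" "x \<notin> fv A1" "occs x A2 = 1"
        | (RL) "z \<notin> fv M1" "occs z M2 = 1" "occs x A1 = 1" "x \<notin> fv A2"
        | (RR) "z \<notin> fv M1" "occs z M2 = 1" "x \<notin> fv A1" "occs x A2 = 1"
        by (auto simp: occs_fresh)
      then show ?thesis
      proof cases
        case LL
        then have "A2 = M2" using eq(2) by (simp add: subst_fresh)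
        from App.IH(1)[OF eq(1) LL(1,3) fr(1,3)] show ?thesis
        proof (elim disjE exE conjE)
          fix B' assume "B = B'[z ::= N]" "M1 = A1[x ::= B']" "occs z B' = 1"
          then show ?thesis using A \<open>A2 = M2\<close> fr by (auto simp: subst_fresh)
        next
          fix C assume C: "M1 = C[x ::= B]" "A1 = C[z ::= N]" "x \<in> fv C" "occs z C = 1"
          then show ?thesis using A \<open>A2 = M2\<close> fr LL(2)
            by (intro disjI2 exI[of _ "App C M2"]) (simp add: subst_fresh occs_fresh)
        qed (use A \<open>A2 = M2\<close> fr LL in \<open>auto simp: subst_fresh\<close>)
      next
        \<comment> \<open>The occurrences lie in different components: \<open>C\<close> takes from
          \<open>M\<close> the side with \<open>z\<close> and from \<open>A\<close> the side with
          \<open>x\<close>, which leaves both holes open.\<close>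
        case LR
        have "x \<in> fv A2" using LR(4) occs_fresh[of x A2] by auto
        with LR show ?thesis using eq fr
          by (intro disjI2 exI[of _ "App M1 A2"]) (simp add: A subst_fresh occs_fresh)
      next
        case RL
        have "x \<in> fv A1" using RL(3) occs_fresh[of x A1] by auto
        with RL show ?thesis using eq fr
          by (intro disjI2 exI[of _ "App A1 M2"]) (simp add: A subst_fresh occs_fresh)
      next
        case RR
        then have "A1 = M1" using eq(1) by (simp add: subst_fresh)
        from App.IH(2)[OF eq(2) RR(2,4) fr(2,4)] show ?thesis
        proof (elim disjE exE conjE)
          fix B' assume "B = B'[z ::= N]" "M2 = A2[x ::= B']" "occs z B' = 1"
          then show ?thesis using A \<open>A1 = M1\<close> fr by (auto simp: subst_fresh)
        next
          fix C assume C: "M2 = C[x ::= B]" "A2 = C[z ::= N]" "x \<in> fv C" "occs z C = 1"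
          then show ?thesis using A \<open>A1 = M1\<close> fr RR(1)
            by (intro disjI2 exI[of _ "App M1 C"]) (simp add: subst_fresh occs_fresh)
        qed (use A \<open>A1 = M1\<close> fr RR in \<open>auto simp: subst_fresh\<close>)
      qed
    qed
  next
    case (Abs M)
    show ?case
    proof (cases A)
      case (FVar y)
      then show ?thesis using Abs.prems by (auto split: if_splits)
    next
      case A: (Abs P)
      have "M[z ::= N] = P[x ::= B]" "occs z M = 1" "occs x P = 1" "x \<notin> fv M" "z \<notin> fv P"
        using Abs.prems A by auto
      from Abs.IH[OF this] show ?thesis
      proof (elim disjE exE conjE)
        fix C assume "M = C[x ::= B]" "P = C[z ::= N]" "x \<in> fv C" "occs z C = 1"
        then show ?thesis using A by (intro disjI2 exI[of _ "Abs C"]) simp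
      qed (use A in auto)
    qed (use Abs.prems in auto)
  qed
  then show ?thesis using that by blast
qed

section \<open>Renaming\<close>

text \<open>Unlike \<open>subst\<close>, an injective renaming commutes with \<open>Lam\<close> and
  with substitution without freshness conditions.\<close>

primrec ren :: "(name \<Rightarrow> name) \<Rightarrow> trm \<Rightarrow> trm" where
  "ren f (FVar x) = FVar (f x)"
| "ren f (BVar i) = BVar i"
| "ren f (App M N) = App (ren f M) (ren f N)"
| "ren f (Abs M) = Abs (ren f M)"

lemma fv_ren [simp]: "fv (ren f M) = f ` fv M"
  by (induction M) auto

lemma ren_id [simp]: "ren id M = M"
  by (induction M) auto

lemma ren_comp: "ren (f \<circ> g) M = ren f (ren g M)"
  by (induction M) auto

lemma ren_close: "inj f \<Longrightarrow> ren f (close k x M) = close k (f x) (ren f M)"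
  by (induction M arbitrary: k) (auto dest: injD)

lemma ren_Lam: "inj f \<Longrightarrow> ren f (Lam x M) = Lam (f x) (ren f M)"
  by (simp add: Lam_def ren_close)

lemma ren_subst: "inj f \<Longrightarrow> ren f (M[x ::= N]) = (ren f M)[f x ::= ren f N]"
  by (induction M) (auto dest: injD)

lemma is_Abs_ren [simp]: "is_Abs (ren f M) = is_Abs M"
  by (cases M) auto

lemma lc_ren [simp]: "lc k (ren f M) = lc k M"
  by (induction M arbitrary: k) auto

lemma lterm_ren [simp]: "lterm (ren f M) = lterm M"
  by (simp add: lterm_iff_lc)

lemma ren_transpose: "y \<notin> fv M \<Longrightarrow> ren (transpose x y) M = M[x ::= FVar y]"
  by (induction M) (auto simp: transpose_def)

section \<open>Typing with total environments\<close>

text \<open>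
  Linearity makes the assumptions used by a term coincide with its free variables, so an environment
  can be a total function. In mode \<open>Gen\<close> the rules are those of \<^const>\<open>typing\<close>. In mode \<open>Dir\<close> an
  abstraction is typed by introduction rules at the root, which gives the disjunction property. In
  mode \<open>Val\<close> an abstraction is typed by \<open>Dir\<close> after case distinctions on types of subterms that
  are not abstractions themselves.
\<close>

datatype mode = Gen | Dir | Val

inductive has :: "mode \<Rightarrow> (name \<Rightarrow> 'a ty) \<Rightarrow> trm \<Rightarrow> 'a ty \<Rightarrow> bool" where
  Var: "has Gen E (FVar x) (E x)"
| Lam: "m \<noteq> Val \<Longrightarrow> x \<in> fv M \<Longrightarrow> has Gen (E(x := \<sigma>)) M \<tau> \<Longrightarrow> has m E (Lam x M) (Arrow \<sigma> \<tau>)"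
| App: "fv M \<inter> fv N = {} \<Longrightarrow> has Gen E M (Arrow \<sigma> \<tau>) \<Longrightarrow> has Gen E N \<sigma> \<Longrightarrow> has Gen E (App M N) \<tau>"
| InterI: "m \<noteq> Val \<Longrightarrow> has m E M \<sigma> \<Longrightarrow> has m E M \<tau> \<Longrightarrow> has m E M (Inter \<sigma> \<tau>)"
| InterE1: "has Gen E M (Inter \<sigma> \<tau>) \<Longrightarrow> has Gen E M \<sigma>"
| InterE2: "has Gen E M (Inter \<sigma> \<tau>) \<Longrightarrow> has Gen E M \<tau>"
| UnionI1: "m \<noteq> Val \<Longrightarrow> has m E M \<sigma> \<Longrightarrow> has m E M (Union \<sigma> \<tau>)"
| UnionI2: "m \<noteq> Val \<Longrightarrow> has m E M \<tau> \<Longrightarrow> has m E M (Union \<sigma> \<tau>)"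
| Leaf: "has Dir E M \<sigma> \<Longrightarrow> has Val E M \<sigma>"
| UnionE: "m \<noteq> Dir \<Longrightarrow> (m = Val \<Longrightarrow> \<not> is_Abs N) \<Longrightarrow> x \<in> fv M \<Longrightarrow> (fv M - {x}) \<inter> fv N = {} \<Longrightarrow>
    has m (E(x := Inter \<sigma> \<theta>)) M \<rho> \<Longrightarrow> has m (E(x := Inter \<tau> \<theta>)) M \<rho> \<Longrightarrow>
    has Gen E N (Inter (Union \<sigma> \<tau>) \<theta>) \<Longrightarrow> has m E (M[x ::= N]) \<rho>"

lemma has_lterm: "has m E M \<sigma> \<Longrightarrow> lterm M"
  by (induction rule: has.induct) (auto intro: lterm.intros lterm_subst)

text \<open>The disjointness premises of \<open>App\<close> and \<open>UnionE\<close> leave no room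
  for a second occurrence. Linearity can thus be read off any derivation, which supplies the
  \<open>occs\<close> conditions of interpolation.\<close>

lemma has_occs: "has m E M \<sigma> \<Longrightarrow> x \<in> fv M \<Longrightarrow> occs x M = 1"
proof (induction arbitrary: x rule: has.induct)
  case (Lam m y M E \<sigma> \<tau>)
  then show ?case by (auto simp: Lam_def)
next
  case (App M N E \<sigma> \<tau>)
  then have "x \<notin> fv M \<and> occs x N = 1 \<or> x \<notin> fv N \<and> occs x M = 1" by auto
  then show ?case by (auto simp flip: occs_fresh)
next
  case (UnionE m N y M E \<sigma> \<theta> \<rho> \<tau>)
  show ?case
  proof (cases "x \<in> fv N")
    case True
    then have "x = y \<or> x \<notin> fv M" using UnionE by auto
    with True UnionE.IH(1)[of y] UnionE.IH(3)[of x] UnionE.hyps(3) occs_fresh[of x M]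
    show ?thesis by (auto simp: occs_subst)
  next
    case False
    then have "x \<noteq> y" "x \<in> fv M" using UnionE by (auto simp: fv_subst)
    with UnionE.IH(1)[of x] False occs_fresh[of x N] show ?thesis by (auto simp: occs_subst)
  qed
qed auto

text \<open>Environments are compared on free variables only, so \<open>f = id\<close> yields
  \<open>has_agree\<close>.\<close>

lemma has_ren:
  "has m E M \<sigma> \<Longrightarrow> inj f \<Longrightarrow> (\<And>x. x \<in> fv M \<Longrightarrow> E' (f x) = E x) \<Longrightarrow> has m E' (ren f M) \<sigma>"
proof (induction arbitrary: E' rule: has.induct)
  case (Var E x)
  then show ?case by (metis fv.simps(1) has.Var insertI1 ren.simps(1))
next
  case (Lam m x M E \<sigma> \<tau>)
  have "has Gen (E'(f x := \<sigma>)) (ren f M) \<tau>"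
    using Lam by (intro Lam.IH) (auto dest: injD)
  then show ?case using Lam by (auto simp: ren_Lam intro: has.Lam)
next
  case (App M N E \<sigma> \<tau>)
  then have "f ` fv M \<inter> f ` fv N = {}" by (auto dest: injD)
  with App show ?case by (auto intro!: has.App[of _ _ _ \<sigma>])
next
  case (UnionE m N x M E \<sigma> \<theta> \<rho> \<tau>)
  have disj: "(fv (ren f M) - {f x}) \<inter> fv (ren f N) = {}"
    using UnionE.hyps(4) UnionE.prems(1) by (auto dest: injD)
  have *: "(E'(f x := \<nu>)) (f v) = (E(x := \<nu>)) v" if "v \<in> fv M" for v \<nu>
    using UnionE.prems UnionE.hyps(3) that by (auto simp: fv_subst dest: injD)
  have 1: "has m (E'(f x := Inter \<sigma> \<theta>)) (ren f M) \<rho>"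
    using UnionE.prems(1) * by (rule UnionE.IH(1))
  have 2: "has m (E'(f x := Inter \<tau> \<theta>)) (ren f M) \<rho>"
    using UnionE.prems(1) * by (rule UnionE.IH(2))
  have 3: "has Gen E' (ren f N) (Inter (Union \<sigma> \<tau>) \<theta>)"
    using UnionE.prems(1) by (rule UnionE.IH(3)) (use UnionE.prems(2) UnionE.hyps(3) in \<open>simp add: fv_subst\<close>)
  show ?case unfolding ren_subst[OF UnionE.prems(1)]
    by (rule has.UnionE[OF UnionE.hyps(1) _ _ disj 1 2 3]) (use UnionE.hyps(2,3) in auto)
qed (blast intro: has.intros)+

lemma has_agree: "has m E M \<sigma> \<Longrightarrow> (\<And>x. x \<in> fv M \<Longrightarrow> E' x = E x) \<Longrightarrow> has m E' M \<sigma>"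
  using has_ren[of m E M \<sigma> id E'] by simp

lemma has_upd_fresh: "x \<notin> fv M \<Longrightarrow> has m (E(x := \<tau>)) M \<sigma> \<longleftrightarrow> has m E M \<sigma>"
  by (auto elim!: has_agree)

text \<open>Barendregt's variable convention: bound variables avoid the names in \<open>A c\<close>.\<close>

lemma has_fresh_induct [consumes 1, case_names Finite Var Lam App InterI InterE1 InterE2 UnionI1 UnionI2
    Leaf UnionE]:
  fixes P :: "'c \<Rightarrow> mode \<Rightarrow> (name \<Rightarrow> 'a ty) \<Rightarrow> trm \<Rightarrow> 'a ty \<Rightarrow> bool"
  assumes "has m E M \<sigma>" and fin: "\<And>c. finite (A c)"
    and "\<And>c E x. P c Gen E (FVar x) (E x)"
    and Lam: "\<And>c m E x M \<sigma> \<tau>. m \<noteq> Val \<Longrightarrow> x \<notin> A c \<Longrightarrow> x \<in> fv M \<Longrightarrow> has Gen (E(x := \<sigma>)) M \<tau> \<Longrightarrow>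
      (\<And>c. P c Gen (E(x := \<sigma>)) M \<tau>) \<Longrightarrow> P c m E (Lam x M) (Arrow \<sigma> \<tau>)"
    and "\<And>c E M N \<sigma> \<tau>. fv M \<inter> fv N = {} \<Longrightarrow> has Gen E M (Arrow \<sigma> \<tau>) \<Longrightarrow> has Gen E N \<sigma> \<Longrightarrow>
      (\<And>c. P c Gen E M (Arrow \<sigma> \<tau>)) \<Longrightarrow> (\<And>c. P c Gen E N \<sigma>) \<Longrightarrow> P c Gen E (App M N) \<tau>"
    and "\<And>c m E M \<sigma> \<tau>. m \<noteq> Val \<Longrightarrow> has m E M \<sigma> \<Longrightarrow> has m E M \<tau> \<Longrightarrow>
      (\<And>c. P c m E M \<sigma>) \<Longrightarrow> (\<And>c. P c m E M \<tau>) \<Longrightarrow> P c m E M (Inter \<sigma> \<tau>)"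
    and "\<And>c E M \<sigma> \<tau>. has Gen E M (Inter \<sigma> \<tau>) \<Longrightarrow> (\<And>c. P c Gen E M (Inter \<sigma> \<tau>)) \<Longrightarrow> P c Gen E M \<sigma>"
    and "\<And>c E M \<sigma> \<tau>. has Gen E M (Inter \<sigma> \<tau>) \<Longrightarrow> (\<And>c. P c Gen E M (Inter \<sigma> \<tau>)) \<Longrightarrow> P c Gen E M \<tau>"
    and "\<And>c m E M \<sigma> \<tau>. m \<noteq> Val \<Longrightarrow> has m E M \<sigma> \<Longrightarrow> (\<And>c. P c m E M \<sigma>) \<Longrightarrow> P c m E M (Union \<sigma> \<tau>)"
    and "\<And>c m E M \<sigma> \<tau>. m \<noteq> Val \<Longrightarrow> has m E M \<tau> \<Longrightarrow> (\<And>c. P c m E M \<tau>) \<Longrightarrow> P c m E M (Union \<sigma> \<tau>)"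
    and "\<And>c E M \<sigma>. has Dir E M \<sigma> \<Longrightarrow> (\<And>c. P c Dir E M \<sigma>) \<Longrightarrow> P c Val E M \<sigma>"
    and UnionE: "\<And>c m E M N x \<sigma> \<tau> \<theta> \<rho>. m \<noteq> Dir \<Longrightarrow> (m = Val \<Longrightarrow> \<not> is_Abs N) \<Longrightarrow> x \<notin> A c \<Longrightarrow> x \<notin> fv N \<Longrightarrow>
      x \<in> fv M \<Longrightarrow> (fv M - {x}) \<inter> fv N = {} \<Longrightarrow>
      has m (E(x := Inter \<sigma> \<theta>)) M \<rho> \<Longrightarrow> (\<And>c. P c m (E(x := Inter \<sigma> \<theta>)) M \<rho>) \<Longrightarrow>
      has m (E(x := Inter \<tau> \<theta>)) M \<rho> \<Longrightarrow> (\<And>c. P c m (E(x := Inter \<tau> \<theta>)) M \<rho>) \<Longrightarrow>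
      has Gen E N (Inter (Union \<sigma> \<tau>) \<theta>) \<Longrightarrow> (\<And>c. P c Gen E N (Inter (Union \<sigma> \<tau>) \<theta>)) \<Longrightarrow>
      P c m E (M[x ::= N]) \<rho>"
  shows "P c m E M \<sigma>"
proof -
  \<comment> \<open>Generalised over injective renamings, so that a binder can be given a fresh name
    by composing with a transposition.\<close>
  have "P c m E' (ren f M) \<sigma>" if "inj f" "\<And>x. x \<in> fv M \<Longrightarrow> E' (f x) = E x" for c E' f
    using assms(1) that
  proof (induction arbitrary: E' f c rule: has.induct)
    case (Var E x)
    then show ?case using assms(3)[of c E' "f x"] by simp
  next
    case (Lam m x M E \<sigma> \<tau>)
    obtain y where y: "y \<notin> A c \<union> fv (ren f M)" using ex_fresh fin finite_fv by (metis finite_UnI)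
    \<comment> \<open>On the free variables of \<open>M\<close> this is \<open>f\<close>, except
      that \<open>x\<close> goes to the fresh \<open>y\<close>.\<close>
    define g where "g = transpose (f x) y \<circ> f"
    have "inj g" using Lam.prems(1) by (simp add: g_def inj_compose)
    have eq: "ren g M = (ren f M)[f x ::= FVar y]" using y by (simp add: g_def ren_comp ren_transpose)
    have *: "ren f (Lam x M) = Lam y (ren g M)"
      using y by (simp add: eq ren_Lam Lam.prems(1) Lam_alpha)
    have g: "(E'(y := \<sigma>)) (g v) = (E(x := \<sigma>)) v" if "v \<in> fv M" for v
    proof (cases "v = x")
      case False
      then have "f v \<noteq> f x" "f v \<noteq> y" using Lam.prems(1) y that by (auto dest: injD)
      then show ?thesis using False Lam.prems(2) that by (simp add: g_def)
    qed (simp add: g_def)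
    have "y \<in> fv (ren g M)" using Lam.hyps(2) by (force simp: g_def)
    moreover have "has Gen (E'(y := \<sigma>)) (ren g M) \<tau>"
      using Lam.hyps(3) \<open>inj g\<close> g by (rule has_ren)
    moreover have "P c Gen (E'(y := \<sigma>)) (ren g M) \<tau>" for c
      using \<open>inj g\<close> g by (rule Lam.IH)
    ultimately show ?case unfolding *
      using y Lam.hyps(1) by (intro assms(4)) auto
  next
    case (App M N E \<sigma> \<tau>)
    then have "fv (ren f M) \<inter> fv (ren f N) = {}" by (auto dest: injD)
    then show ?case
      using App by (auto intro!: assms(5)[of _ _ _ \<sigma>] has_ren)
  next
    case (InterI m E M \<sigma> \<tau>)
    then show ?case by - (rule assms(6); auto intro: has_ren)
  next
    case (InterE1 E M \<sigma> \<tau>)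
    then show ?case by - (rule assms(7)[of _ _ _ \<tau>]; auto intro: has_ren)
  next
    case (InterE2 E M \<sigma> \<tau>)
    then show ?case by - (rule assms(8)[of _ _ \<sigma>]; auto intro: has_ren)
  next
    case (UnionI1 m E M \<sigma> \<tau>)
    then show ?case by - (rule assms(9); auto intro: has_ren)
  next
    case (UnionI2 m E M \<tau> \<sigma>)
    then show ?case by - (rule assms(10); auto intro: has_ren)
  next
    case (Leaf E M \<sigma>)
    then show ?case by - (rule assms(11); auto intro: has_ren)
  next
    case (UnionE m N x M E \<sigma> \<theta> \<rho> \<tau>)
    obtain y where y: "y \<notin> A c \<union> fv (ren f M) \<union> fv (ren f N)"
      using ex_fresh fin finite_fv by (metis finite_UnI)
    define g where "g = transpose (f x) y \<circ> f"
    have "inj g" using UnionE.prems(1) by (simp add: g_def inj_compose)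
    have eq: "ren g M = (ren f M)[f x ::= FVar y]" using y by (simp add: g_def ren_comp ren_transpose)
    have *: "ren f (M[x ::= N]) = (ren g M)[y ::= ren f N]"
      using y by (simp add: eq ren_subst UnionE.prems(1) subst_compose)
    have E': "E' (f v) = E v" if "v \<in> fv M \<and> v \<noteq> x \<or> v \<in> fv N" for v
      using UnionE.prems(2) UnionE.hyps(3) that by (auto simp: fv_subst)
    have g: "(E'(y := \<nu>)) (g v) = (E(x := \<nu>)) v" if "v \<in> fv M" for v \<nu>
    proof (cases "v = x")
      case False
      then have "f v \<noteq> f x" "f v \<noteq> y" using UnionE.prems(1) y that by (auto dest: injD)
      then show ?thesis using False E' that by (simp add: g_def)
    qed (simp add: g_def)
    have yM: "y \<in> fv (ren g M)" using UnionE.hyps(3) by (force simp: g_def)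
    have "fv (ren g M) \<subseteq> fv (ren f M) - {f x} \<union> {y}"
      using fv_subst_subset[of "ren f M" "f x" "FVar y"] by (simp only: eq fv.simps)
    moreover have "(fv (ren f M) - {f x}) \<inter> fv (ren f N) = {}"
      using UnionE.hyps(4) UnionE.prems(1) by (auto dest: injD)
    ultimately have disj: "(fv (ren g M) - {y}) \<inter> fv (ren f N) = {}"
      by blast
    show ?case unfolding *
    proof (rule assms(12)[where \<sigma> = \<sigma> and \<tau> = \<tau> and \<theta> = \<theta>])
      show "has m (E'(y := Inter \<sigma> \<theta>)) (ren g M) \<rho>"
        using UnionE.hyps(5) \<open>inj g\<close> g by (rule has_ren)
      show "has m (E'(y := Inter \<tau> \<theta>)) (ren g M) \<rho>"
        using UnionE.hyps(6) \<open>inj g\<close> g by (rule has_ren)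
      show "P c m (E'(y := Inter \<sigma> \<theta>)) (ren g M) \<rho>" for c
        using \<open>inj g\<close> g by (rule UnionE.IH(1))
      show "P c m (E'(y := Inter \<tau> \<theta>)) (ren g M) \<rho>" for c
        using \<open>inj g\<close> g by (rule UnionE.IH(2))
      show "has Gen E' (ren f N) (Inter (Union \<sigma> \<tau>) \<theta>)"
        using UnionE.hyps(7) UnionE.prems(1) by (rule has_ren) (simp add: E')
      show "P c Gen E' (ren f N) (Inter (Union \<sigma> \<tau>) \<theta>)" for c
        using UnionE.prems(1) by (rule UnionE.IH(3)) (simp add: E')
    qed (use y yM disj UnionE.hyps(1,2) in auto)
  qed
  from this[of id E c] show ?thesis by simp
qed

section \<open>Weakening, cut and union of assumptions\<close>

text \<open>The premise says that \<open>E' x\<close> is a subtype of \<open>E x\<close>.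
  Assumptions are used only at \<open>Var\<close>, which is always in mode \<open>Gen\<close>, so
  the other modes are preserved.\<close>

lemma has_weaken:
  "has m E M \<sigma> \<Longrightarrow> (\<And>x. x \<in> fv M \<Longrightarrow> has Gen E' (FVar x) (E x)) \<Longrightarrow> has m E' M \<sigma>"
proof (induction arbitrary: E' rule: has.induct)
  case (Var E x)
  then show ?case by simp
next
  case (Lam m x M E \<sigma> \<tau>)
  have "has Gen (E'(x := \<sigma>)) (FVar v) ((E(x := \<sigma>)) v)" if "v \<in> fv M" for v
    using that Lam.prems[of v] has.Var[of "E'(x := \<sigma>)" x]
    by (cases "v = x") (auto simp: has_upd_fresh)
  then show ?case using Lam by (auto intro: has.Lam)
next
  case (App M N E \<sigma> \<tau>)
  then show ?case by (auto intro!: has.App[of _ _ _ \<sigma>])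
next
  case (UnionE m N x M E \<sigma> \<theta> \<rho> \<tau>)
  have "has Gen (E'(x := \<nu>)) (FVar v) ((E(x := \<nu>)) v)" if "v \<in> fv M" for v \<nu>
    using that UnionE.prems[of v] has.Var[of "E'(x := \<nu>)" x] UnionE.hyps(3)
    by (cases "v = x") (auto simp: has_upd_fresh fv_subst)
  note * = this
  have "has m (E'(x := Inter \<sigma> \<theta>)) M \<rho>" by (rule UnionE.IH(1)) (rule *)
  moreover have "has m (E'(x := Inter \<tau> \<theta>)) M \<rho>" by (rule UnionE.IH(2)) (rule *)
  moreover have "has Gen E' N (Inter (Union \<sigma> \<tau>) \<theta>)"
    using UnionE.prems UnionE.hyps(3) by (auto simp: fv_subst intro: UnionE.IH(3))
  ultimately show ?case using UnionE.hyps(1-4) by (intro has.UnionE) auto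
qed (blast intro: has.intros)+

lemma has_Var_upd: "has Gen (E(x := \<sigma>)) (FVar x) \<sigma>"
  using has.Var[of "E(x := \<sigma>)" x] by simp

lemma has_weaken_upd:
  assumes "has m (E(x := \<sigma>)) M \<rho>" "has Gen (E(x := \<tau>)) (FVar x) \<sigma>"
  shows "has m (E(x := \<tau>)) M \<rho>"
  using assms(1)
proof (rule has_weaken)
  fix v
  show "has Gen (E(x := \<tau>)) (FVar v) ((E(x := \<sigma>)) v)"
    using assms(2) has.Var[of "E(x := \<tau>)" v] by (cases "v = x") auto
qed

text \<open>A cut is the degenerate case distinction on \<open>Union \<sigma> \<sigma>\<close>, with
  \<theta> = \<sigma>.\<close>

lemma has_cut:
  assumes "has Gen (E(x := \<sigma>)) M \<rho>" "has Gen E N \<sigma>" "x \<in> fv M" "(fv M - {x}) \<inter> fv N = {}"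
  shows "has Gen E (M[x ::= N]) \<rho>"
proof -
  have "has Gen (E(x := Inter \<sigma> \<sigma>)) M \<rho>"
    using assms(1) by (rule has_weaken_upd) (rule has.InterE1[OF has_Var_upd])
  then show ?thesis
    using assms by (auto intro!: has.UnionE[of Gen N x M E \<sigma> \<sigma> \<rho> \<sigma>] has.InterI has.UnionI1)
qed

text \<open>The case distinction is made on \<open>x\<close> itself, through the identity
  substitution; mode \<open>Val\<close> permits it because a variable is not an abstraction. The
  union is repeated as \<theta>, which has to be some type of \<open>x\<close>.\<close>

lemma has_join:
  assumes "has m (E(x := \<sigma>)) M \<rho>" "has m (E(x := \<tau>)) M \<rho>" "x \<in> fv M" "m \<noteq> Dir"
  shows "has m (E(x := Union \<sigma> \<tau>)) M \<rho>"
proof -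
  have "has m (E(x := Inter \<sigma> (Union \<sigma> \<tau>))) M \<rho>" "has m (E(x := Inter \<tau> (Union \<sigma> \<tau>))) M \<rho>"
    using assms(1,2)[THEN has_weaken_upd] has.InterE1[OF has_Var_upd] by blast+
  then have "has m (E(x := Union \<sigma> \<tau>)) (M[x ::= FVar x]) \<rho>"
    using assms by (intro has.UnionE[where \<sigma> = \<sigma> and \<tau> = \<tau> and \<theta> = "Union \<sigma> \<tau>"])
      (auto intro: has.InterI has_Var_upd)
  then show ?thesis by simp
qed

section \<open>Interpolation\<close>

text \<open>Here \<open>N\<close> is the whole term and its type \<rho> is the interpolant.
  Variables are typed in mode \<open>Gen\<close> only, hence the restriction on
  \<open>m\<close>.\<close>

lemma has_interpolation_FVar:
  "has m E T \<rho> \<Longrightarrow> T = M[z ::= N] \<Longrightarrow> (m \<noteq> Gen \<Longrightarrow> M \<noteq> FVar z) \<Longrightarrow> M = FVar z \<Longrightarrow>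
    \<exists>\<tau>. has Gen E N \<tau> \<and> has m (E(z := \<tau>)) M \<rho>"
  using has_Var_upd[of E z \<rho>] by fastforce

text \<open>The single occurrence of \<open>N\<close> is followed up the derivation; the fresh
  induction keeps bound variables apart from \<open>z\<close>. Two typings of one term by
  \<open>InterI\<close> give two interpolants, and their intersection serves both. The critical rule
  is \<open>UnionE\<close>, where \<open>N\<close> and the substituted \<open>B\<close> are nested
  or disjoint.\<close>

lemma has_interpolation:
  "has m E T \<rho> \<Longrightarrow> T = M[z ::= N] \<Longrightarrow> occs z M = 1 \<Longrightarrow> z \<notin> fv T \<Longrightarrow> lterm M \<Longrightarrow> lterm N \<Longrightarrow>
    (m \<noteq> Gen \<Longrightarrow> M \<noteq> FVar z) \<Longrightarrow> \<exists>\<tau>. has Gen E N \<tau> \<and> has m (E(z := \<tau>)) M \<rho>"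
proof (induction z m E T \<rho> arbitrary: M N rule: has_fresh_induct[where A = "\<lambda>z. {z}"])
  case (Finite z)
  show ?case by simp
next
  case (Var z E x)
  then have "M = FVar z" by (cases M) (auto split: if_splits)
  from has_interpolation_FVar[OF has.Var Var.prems(1,6) this] show ?case .
next
  case (Lam z m E x T \<sigma> \<tau>)
  show ?case
  proof (cases "M = FVar z")
    case True
    from has_interpolation_FVar[OF has.Lam[OF Lam.hyps(1,3,4)] Lam.prems(1,6) this] show ?thesis .
  next
    case False
    have zM: "z \<in> fv M" using Lam.prems(2) occs_fresh[of z M] by auto
    have "x \<noteq> z" using Lam.hyps(2) by auto
    have fv: "fv T - {x} = fv M - {z} \<union> fv N"
      using Lam.prems(1) zM by (metis fv_Lam fv_subst)
    then have x: "x \<notin> fv M" "x \<notin> fv N" using \<open>x \<noteq> z\<close> by auto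
    obtain P where P: "M = Abs P"
      using False Lam.prems(1) by (cases M) (auto simp: Lam_def split: if_splits)
    obtain M' where M': "M = Lam x M'" "lterm M'"
      using Lam_cases_fresh[of P x] Lam.prems(4) x(1) P by auto
    have "Lam x T = Lam x (M'[z ::= N])"
      using Lam.prems(1) M'(1) Lam_subst[OF \<open>x \<noteq> z\<close> x(2)] by simp
    then have T: "T = M'[z ::= N]"
      using has_lterm[OF Lam.hyps(4)] M'(2) Lam.prems(5) by (auto intro: Lam_inject lterm_subst)
    have occ: "occs z M' = 1" using Lam.prems(2) M'(1) \<open>x \<noteq> z\<close> by (simp add: Lam_def)
    have zT: "z \<notin> fv T" using Lam.prems(3) \<open>x \<noteq> z\<close> by simp
    obtain \<nu> where \<nu>: "has Gen (E(x := \<sigma>)) N \<nu>" "has Gen (E(x := \<sigma>, z := \<nu>)) M' \<tau>"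
      using Lam.IH[OF T occ zT M'(2) Lam.prems(5)] by blast
    have "x \<in> fv M'"
      using Lam.hyps(3) x(2) fv_subst_subset[of M' z N] T by auto
    then have "has m (E(z := \<nu>)) M (Arrow \<sigma> \<tau>)"
      using \<nu>(2) Lam.hyps(1) \<open>x \<noteq> z\<close> M'(1) by (auto intro: has.Lam simp: fun_upd_twist)
    moreover have "has Gen E N \<nu>" using \<nu>(1) x(2) by (simp add: has_upd_fresh)
    ultimately show ?thesis by blast
  qed
next
  case (App z E T1 T2 \<sigma> \<tau>)
  show ?case
  proof (cases "M = FVar z")
    case True
    from has_interpolation_FVar[OF has.App[OF App.hyps] App.prems(1,6) this] show ?thesis .
  next
    case False
    then obtain M1 M2 where M: "M = App M1 M2"
      using App.prems(1) by (cases M) (auto split: if_splits)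
    then have T: "T1 = M1[z ::= N]" "T2 = M2[z ::= N]" using App.prems(1) by auto
    have lt: "lterm M1" "lterm M2" using App.prems(4) M by auto
    have z: "z \<notin> fv T1" "z \<notin> fv T2" using App.prems(3) by auto
    consider "occs z M1 = 1" "z \<notin> fv M2" | "z \<notin> fv M1" "occs z M2 = 1"
      using App.prems(2) M occs_fresh[of z M1] occs_fresh[of z M2] by fastforce
    then show ?thesis
    proof cases
      case 1
      obtain \<nu> where \<nu>: "has Gen E N \<nu>" "has Gen (E(z := \<nu>)) M1 (Arrow \<sigma> \<tau>)"
        using App.IH(1)[OF T(1) 1(1) z(1) lt(1) App.prems(5)] by blast
      have "T2 = M2" using T(2) 1 by (simp add: subst_fresh)
      then have "has Gen (E(z := \<nu>)) M2 \<sigma>" using App.hyps(3) 1 by (simp add: has_upd_fresh)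
      moreover have "fv M1 - {z} \<subseteq> fv T1" using fv_subst[of z M1 N] 1 occs_fresh[of z M1] T(1) by auto
      then have "fv M1 \<inter> fv M2 = {}" using App.hyps(1) \<open>T2 = M2\<close> 1 by auto
      ultimately have "has Gen (E(z := \<nu>)) M \<tau>" using \<nu>(2) M by (blast intro: has.App)
      then show ?thesis using \<nu>(1) by blast
    next
      case 2
      obtain \<nu> where \<nu>: "has Gen E N \<nu>" "has Gen (E(z := \<nu>)) M2 \<sigma>"
        using App.IH(2)[OF T(2) 2(2) z(2) lt(2) App.prems(5)] by blast
      have "T1 = M1" using T(1) 2 by (simp add: subst_fresh)
      then have "has Gen (E(z := \<nu>)) M1 (Arrow \<sigma> \<tau>)" using App.hyps(2) 2 by (simp add: has_upd_fresh)
      moreover have "fv M2 - {z} \<subseteq> fv T2" using fv_subst[of z M2 N] 2 occs_fresh[of z M2] T(2) by auto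
      then have "fv M1 \<inter> fv M2 = {}" using App.hyps(1) \<open>T1 = M1\<close> 2 by auto
      ultimately have "has Gen (E(z := \<nu>)) M \<tau>" using \<nu>(2) M by (blast intro: has.App)
      then show ?thesis using \<nu>(1) by blast
    qed
  qed
next
  case (InterI z m E T \<sigma> \<tau>)
  from InterI.IH(1)[OF InterI.prems] InterI.IH(2)[OF InterI.prems] obtain \<nu> \<nu>' where
    \<nu>: "has Gen E N \<nu>" "has m (E(z := \<nu>)) M \<sigma>" "has Gen E N \<nu>'" "has m (E(z := \<nu>')) M \<tau>"
    by blast
  have "has m (E(z := Inter \<nu> \<nu>')) M \<sigma>"
    using \<nu>(2) has.InterE1[OF has_Var_upd] by (rule has_weaken_upd)
  moreover have "has m (E(z := Inter \<nu> \<nu>')) M \<tau>"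
    using \<nu>(4) has.InterE2[OF has_Var_upd] by (rule has_weaken_upd)
  moreover have "has Gen E N (Inter \<nu> \<nu>')" using \<nu>(1,3) by (auto intro: has.InterI)
  ultimately show ?case using InterI.hyps(1) by (blast intro: has.InterI)
next
  case (InterE1 z E T \<sigma> \<tau>)
  from InterE1.IH[OF InterE1.prems] show ?case by (blast intro: has.InterE1)
next
  case (InterE2 z E T \<sigma> \<tau>)
  from InterE2.IH[OF InterE2.prems] show ?case by (blast intro: has.InterE2)
next
  case (UnionI1 z m E T \<sigma> \<tau>)
  from UnionI1.IH[OF UnionI1.prems] UnionI1.hyps(1) show ?case by (blast intro: has.UnionI1)
next
  case (UnionI2 z m E T \<sigma> \<tau>)
  from UnionI2.IH[OF UnionI2.prems] UnionI2.hyps(1) show ?case by (blast intro: has.UnionI2)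
next
  case (Leaf z E T \<sigma>)
  have "M \<noteq> FVar z" using Leaf.prems(6) by auto
  from Leaf.IH[OF Leaf.prems(1-5) this] show ?case by (blast intro: has.Leaf)
next
  case (UnionE z m E A B x \<sigma> \<tau> \<theta> \<rho>)
  show ?case
  proof (cases "M = FVar z")
    case True
    from has_interpolation_FVar[OF has.UnionE[OF UnionE.hyps(1,2,5-9)] UnionE.prems(1,6) this]
    show ?thesis .
  next
    case False
    have "x \<noteq> z" using UnionE.hyps(3) by auto
    have zM: "z \<in> fv M" using UnionE.prems(2) occs_fresh[of z M] by auto
    have fvA: "fv (A[x ::= B]) = fv A - {x} \<union> fv B" using UnionE.hyps(5) by (rule fv_subst)
    have fvM: "fv (M[z ::= N]) = fv M - {z} \<union> fv N" using zM by (rule fv_subst)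
    have xM: "x \<notin> fv M" and xN: "x \<notin> fv N"
      using fvA fvM UnionE.prems(1) UnionE.hyps(4) \<open>x \<noteq> z\<close> by auto
    have zA: "z \<notin> fv A" and zB: "z \<notin> fv B"
      using fvA UnionE.prems(3) \<open>x \<noteq> z\<close> by auto
    have upd: "has m (E(x := \<sigma>', z := \<tau>')) Q \<rho>' \<longleftrightarrow> has m (E(z := \<tau>', x := \<sigma>')) Q \<rho>'"
      for m \<sigma>' \<tau>' Q \<rho>' using \<open>x \<noteq> z\<close> by (simp add: fun_upd_twist)
    note ltA = has_lterm[OF UnionE.hyps(7)] and ltB = has_lterm[OF UnionE.hyps(9)]
    show ?thesis
      using UnionE.prems(1)[symmetric] UnionE.prems(2) has_occs[OF UnionE.hyps(7,5)] xM zA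
    proof (cases rule: subst_eq_subst_cases)
      \<comment> \<open>\<open>N\<close> contains \<open>B\<close>, so the branches may give
        \<open>N'\<close> different types. The case distinction moves into the typing of
        \<open>N\<close>, which receives their union, and \<open>M\<close>, free of
        \<open>x\<close>, accepts both.\<close>
      case (outer N')
      have ltN': "lterm N'" using UnionE.prems(5) outer(1) lterm_substD by blast
      from UnionE.IH(1)[OF outer(2) UnionE.prems(2) zA UnionE.prems(4) ltN' UnionE.prems(6)]
        UnionE.IH(2)[OF outer(2) UnionE.prems(2) zA UnionE.prems(4) ltN' UnionE.prems(6)]
      obtain \<nu> \<nu>' where \<nu>:
        "has Gen (E(x := Inter \<sigma> \<theta>)) N' \<nu>" "has m (E(x := Inter \<sigma> \<theta>, z := \<nu>)) M \<rho>"
        "has Gen (E(x := Inter \<tau> \<theta>)) N' \<nu>'" "has m (E(x := Inter \<tau> \<theta>, z := \<nu>')) M \<rho>"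
        by blast
      then have "has m (E(z := \<nu>)) M \<rho>" "has m (E(z := \<nu>')) M \<rho>"
        using xM by (auto simp: upd has_upd_fresh)
      then have M: "has m (E(z := Union \<nu> \<nu>')) M \<rho>" using zM UnionE.hyps(1) by (rule has_join)
      have "fv N' \<subseteq> fv A" using fv_subst[OF zM, of N'] outer(2) by auto
      then have "(fv N' - {x}) \<inter> fv B = {}" using UnionE.hyps(6) by auto
      then have "has Gen E (N'[x ::= B]) (Union \<nu> \<nu>')"
        using has.UnionI1[OF _ \<nu>(1)] has.UnionI2[OF _ \<nu>(3)]
        by (intro has.UnionE[OF _ _ outer(3) _ _ _ UnionE.hyps(9)]) auto
      then show ?thesis using M outer(1) by blast
    next
      \<comment> \<open>\<open>N\<close> lies inside \<open>B\<close>: only the typing of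
        \<open>B\<close> is split, and the same cases are distinguished on
        \<open>B'\<close>.\<close>
      case (inner B')
      have "lterm B'" using ltB inner(1) lterm_substD by blast
      from UnionE.IH(3)[OF inner(1,3) zB this UnionE.prems(5)] obtain \<nu> where \<nu>:
        "has Gen E N \<nu>" "has Gen (E(z := \<nu>)) B' (Inter (Union \<sigma> \<tau>) \<theta>)" by blast
      have "has m (E(z := \<nu>, x := Inter \<sigma> \<theta>)) A \<rho>" "has m (E(z := \<nu>, x := Inter \<tau> \<theta>)) A \<rho>"
        using UnionE.hyps(7,8) zA by (auto simp: has_upd_fresh simp flip: upd)
      moreover have "z \<in> fv B'" using inner(3) occs_fresh[of z B'] by auto
      then have "fv B' \<subseteq> fv B \<union> {z}" using fv_subst[of z B' N] inner(1) by auto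
      then have "(fv A - {x}) \<inter> fv B' = {}" using UnionE.hyps(6) zA by auto
      moreover have "\<not> is_Abs B'" if "m = Val" using UnionE.hyps(2) that inner(1) is_Abs_subst by blast
      ultimately have "has m (E(z := \<nu>)) (A[x ::= B']) \<rho>"
        using UnionE.hyps(1,5) \<nu>(2) by (intro has.UnionE[where \<sigma> = \<sigma> and \<tau> = \<tau> and \<theta> = \<theta>]) auto
      then show ?thesis using \<nu>(1) inner(2) by blast
    next
      \<comment> \<open>\<open>N\<close> does not depend on \<open>x\<close>, so it has the
        interpolants of both branches outright, and the case distinction stays with
        \<open>C\<close>.\<close>
      case (disjoint C)
      have ltC: "lterm C" using UnionE.prems(4) disjoint(1) lterm_substD by blast
      have C: "C \<noteq> FVar z" using disjoint(3) \<open>x \<noteq> z\<close> by auto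
      from UnionE.IH(1)[OF disjoint(2,4) zA ltC UnionE.prems(5) C]
        UnionE.IH(2)[OF disjoint(2,4) zA ltC UnionE.prems(5) C]
      obtain \<nu> \<nu>' where \<nu>:
        "has Gen (E(x := Inter \<sigma> \<theta>)) N \<nu>" "has m (E(x := Inter \<sigma> \<theta>, z := \<nu>)) C \<rho>"
        "has Gen (E(x := Inter \<tau> \<theta>)) N \<nu>'" "has m (E(x := Inter \<tau> \<theta>, z := \<nu>')) C \<rho>"
        by blast
      then have N: "has Gen E N (Inter \<nu> \<nu>')" using xN by (auto simp: has_upd_fresh intro: has.InterI)
      have 1: "has m (E(z := Inter \<nu> \<nu>', x := Inter \<sigma> \<theta>)) C \<rho>"
        using has_weaken_upd[OF \<nu>(2) has.InterE1[OF has_Var_upd]] by (simp add: upd)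
      have 2: "has m (E(z := Inter \<nu> \<nu>', x := Inter \<tau> \<theta>)) C \<rho>"
        using has_weaken_upd[OF \<nu>(4) has.InterE2[OF has_Var_upd]] by (simp add: upd)
      have 3: "has Gen (E(z := Inter \<nu> \<nu>')) B (Inter (Union \<sigma> \<tau>) \<theta>)"
        using UnionE.hyps(9) zB by (simp add: has_upd_fresh)
      have "z \<in> fv C" using disjoint(4) occs_fresh[of z C] by auto
      then have "fv C \<subseteq> fv A \<union> {z}" using fv_subst[of z C N] disjoint(2) by auto
      then have disj: "(fv C - {x}) \<inter> fv B = {}" using UnionE.hyps(6) zB by auto
      have "has m (E(z := Inter \<nu> \<nu>')) (C[x ::= B]) \<rho>"
        by (rule has.UnionE[OF UnionE.hyps(1) _ disjoint(3) disj 1 2 3]) (rule UnionE.hyps(2))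
      then show ?thesis using N disjoint(1) by blast
    qed
  qed
qed

section \<open>Direct typings and the disjunction property\<close>

inductive_cases has_Dir_InterE: "has Dir E M (Inter \<sigma> \<tau>)"
inductive_cases has_Dir_UnionE: "has Dir E M (Union \<sigma> \<tau>)"
inductive_cases has_Dir_ArrowE: "has Dir E M (Arrow \<sigma> \<tau>)"

lemma has_Dir_Inter [simp]: "has Dir E M (Inter \<sigma> \<tau>) \<longleftrightarrow> has Dir E M \<sigma> \<and> has Dir E M \<tau>"
  by (auto elim: has_Dir_InterE intro: has.InterI)

text \<open>Mode \<open>Dir\<close> has no elimination rules, so a union can only have been
  introduced. This settles any case distinction on a directly typed term.\<close>

lemma has_Dir_Union [simp]: "has Dir E M (Union \<sigma> \<tau>) \<longleftrightarrow> has Dir E M \<sigma> \<or> has Dir E M \<tau>"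
  by (auto elim: has_Dir_UnionE intro: has.UnionI1 has.UnionI2)

lemma has_Dir_imp_Gen: "has m E M \<sigma> \<Longrightarrow> m = Dir \<Longrightarrow> has Gen E M \<sigma>"
  by (induction rule: has.induct) (auto intro: has.Lam has.InterI has.UnionI1 has.UnionI2)

lemma has_Val_imp_Gen: "has m E M \<sigma> \<Longrightarrow> m = Val \<Longrightarrow> has Gen E M \<sigma>"
proof (induction rule: has.induct)
  case (UnionE m N x M E \<sigma> \<theta> \<rho> \<tau>)
  then show ?case by (intro has.UnionE[where \<sigma> = \<sigma> and \<tau> = \<tau> and \<theta> = \<theta>]) (auto simp del: fun_upd_apply)
qed (auto intro: has_Dir_imp_Gen)

lemma has_imp_is_Abs: "has m E M \<sigma> \<Longrightarrow> m \<noteq> Gen \<Longrightarrow> is_Abs M"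
  by (induction rule: has.induct) (auto simp: is_Abs_subst)

lemma subst_eq_FVar: "M[x ::= N] = FVar z \<Longrightarrow> x \<in> fv M \<Longrightarrow> M = FVar x \<and> N = FVar z"
  by (cases M) (auto split: if_splits)

text \<open>Direct typings are closed under subtyping, given as a typing of a variable. A union
  elimination there is again on a variable, and the disjunction property tells which branch to
  follow.\<close>

lemma has_Dir_mono:
  "has m E T \<rho> \<Longrightarrow> T = FVar x \<Longrightarrow> has Dir F N (E x) \<Longrightarrow> has Dir F N \<rho>"
proof (induction arbitrary: x rule: has.induct)
  case (UnionE m B y A E \<sigma> \<theta> \<rho> \<tau>)
  then have A: "A = FVar y" "B = FVar x" using subst_eq_FVar by blast+
  from UnionE.IH(3)[OF A(2)] UnionE.prems(2)
  have "has Dir F N \<sigma> \<or> has Dir F N \<tau>" "has Dir F N \<theta>" by auto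
  then show ?case using UnionE.IH(1,2)[OF A(1)] by auto
qed (auto intro: has.UnionI1 has.UnionI2)

section \<open>Normal typings of abstractions\<close>

text \<open>A case distinction has the type of its branches, so a change of type that is sound for
  direct typings can be made at the leaves.\<close>

lemma has_Val_mono:
  assumes "has m E N \<sigma>" "m = Val" "\<And>E N. has Dir E N \<sigma> \<Longrightarrow> has Dir E N \<tau>"
  shows "has Val E N \<tau>"
  using assms
proof (induction rule: has.induct)
  case (UnionE m N x M E \<sigma> \<theta> \<rho> \<tau>')
  then show ?case by (intro has.UnionE[where \<sigma> = \<sigma> and \<tau> = \<tau>' and \<theta> = \<theta>]) (auto simp del: fun_upd_apply)
qed (auto intro: has.Leaf)

text \<open>
  A case distinction in the derivation on the left is replayed on the right by interpolating there
  the subterm it is made on.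
\<close>

lemma has_Val_combine:
  assumes "has m E N \<sigma>" "m = Val"
    and "\<And>x. x \<in> fv N \<Longrightarrow> has Gen E' (FVar x) (E x)"
    and "has m' E' N \<sigma>'" "m' \<noteq> Gen"
    and comb: "\<And>E N. has Dir E N \<sigma> \<Longrightarrow> has m' E N \<sigma>' \<Longrightarrow> has Val E N \<tau>"
  shows "has Val E' N \<tau>"
  using assms(1-4) comb
proof (induction E' m E N \<sigma> rule: has_fresh_induct[where A = "\<lambda>_. {}"])
  case (Leaf E' E N \<sigma>)
  then show ?case using has_weaken by blast
next
  case (UnionE E' m E M B x \<sigma> \<sigma>2 \<theta> \<rho>)
  have m: "m = Val" using UnionE.prems(1) .
  have M: "M \<noteq> FVar x" using has_imp_is_Abs[OF UnionE.hyps(7)] m by auto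
  have fv: "fv (M[x ::= B]) = fv M - {x} \<union> fv B" using UnionE.hyps(5) by (rule fv_subst)
  note lt = has_lterm[OF UnionE.hyps(7)] has_lterm[OF UnionE.hyps(9)]
  \<comment> \<open>The second typing is opened at the term \<open>B\<close> on which the first
    distinguishes cases. As \<open>M\<close> is an abstraction, interpolation outside
    \<open>Gen\<close> applies.\<close>
  obtain \<nu> where \<nu>: "has Gen E' B \<nu>" "has m' (E'(x := \<nu>)) M \<sigma>'"
    using has_interpolation[OF UnionE.prems(3) refl has_occs[OF UnionE.hyps(7,5)] _ lt] M UnionE.hyps(4) fv
    by auto
  have "has Gen E' B (Inter (Union \<sigma> \<sigma>2) \<theta>)"
    using UnionE.hyps(9) by (rule has_weaken) (use UnionE.prems(2) fv in auto)
  \<comment> \<open>The interpolant joins \<theta>: in each branch \<open>x\<close> then has the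
    type required by the first typing and also \<nu>, required by the second.\<close>
  then have B: "has Gen E' B (Inter (Union \<sigma> \<sigma>2) (Inter \<theta> \<nu>))"
    using \<nu>(1) by (auto intro: has.InterI has.InterE1 has.InterE2)
  have *: "has Val (E'(x := Inter \<kappa> (Inter \<theta> \<nu>))) M \<tau>"
    if "\<And>E'. m = Val \<Longrightarrow> (\<And>v. v \<in> fv M \<Longrightarrow> has Gen E' (FVar v) ((E(x := Inter \<kappa> \<theta>)) v)) \<Longrightarrow>
      has m' E' M \<sigma>' \<Longrightarrow> has Val E' M \<tau>" for \<kappa>
  proof (rule that[OF m])
    let ?E = "E'(x := Inter \<kappa> (Inter \<theta> \<nu>))"
    have x: "has Gen ?E (FVar x) (Inter \<kappa> (Inter \<theta> \<nu>))" by (rule has_Var_upd)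
    then have "has Gen ?E (FVar x) \<kappa>" "has Gen ?E (FVar x) (Inter \<theta> \<nu>)"
      by (blast intro: has.InterE1 has.InterE2)+
    then have *: "has Gen ?E (FVar x) (Inter \<kappa> \<theta>)" "has Gen ?E (FVar x) \<nu>"
      by (blast intro: has.InterI has.InterE1 has.InterE2)+
    show "has Gen ?E (FVar v) ((E(x := Inter \<kappa> \<theta>)) v)" if "v \<in> fv M" for v
      using *(1) UnionE.prems(2)[of v] fv that by (cases "v = x") (auto simp: has_upd_fresh)
    show "has m' ?E M \<sigma>'" using \<nu>(2) *(2) by (rule has_weaken_upd)
  qed
  show ?case
  proof (rule has.UnionE[OF _ _ UnionE.hyps(5,6) _ _ B])
    show "has Val (E'(x := Inter \<sigma> (Inter \<theta> \<nu>))) M \<tau>"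
      by (rule *, rule UnionE.IH(1)[OF _ _ _ UnionE.prems(4)])
    show "has Val (E'(x := Inter \<sigma>2 (Inter \<theta> \<nu>))) M \<tau>"
      by (rule *, rule UnionE.IH(2)[OF _ _ _ UnionE.prems(4)])
  qed (use UnionE.hyps(2) m in auto)
qed auto

text \<open>\<open>Val\<close> has no rule \<open>InterI\<close>, since the two typings may
  distinguish different cases. Combining once reduces the first typing to its leaves; combining
  again with the roles exchanged leaves two direct typings.\<close>

lemma has_Val_Inter:
  assumes "has Val E N \<sigma>" "has Val E N \<tau>"
  shows "has Val E N (Inter \<sigma> \<tau>)"
proof (rule has_Val_combine[OF assms(1) refl has.Var assms(2)])
  fix E N assume "has Dir E N \<sigma>" "has Val E N \<tau>"
  then show "has Val E N (Inter \<sigma> \<tau>)"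
    by (intro has_Val_combine[OF \<open>has Val E N \<tau>\<close> refl has.Var \<open>has Dir E N \<sigma>\<close>])
      (auto intro: has.Leaf)
qed auto

text \<open>The substitution takes place in bodies of abstractions, which are typed in
  \<open>Gen\<close>, so a cut there suffices and \<open>B\<close> may be of any shape.\<close>

lemma has_Dir_subst:
  "has m F A \<rho> \<Longrightarrow> m = Dir \<Longrightarrow> (\<And>v. v \<in> fv A - {x} \<Longrightarrow> E v = F v) \<Longrightarrow> has Gen E B (F x) \<Longrightarrow>
    x \<in> fv A \<Longrightarrow> (fv A - {x}) \<inter> fv B = {} \<Longrightarrow> has Dir E (A[x ::= B]) \<rho>"
proof (induction x m F A \<rho> rule: has_fresh_induct[where A = "\<lambda>x. insert x (fv B)"])
  case (Lam x m F y M \<sigma> \<tau>)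
  have y: "y \<noteq> x" "y \<notin> fv B" "x \<in> fv M" using Lam.hyps(2) Lam.prems(4) by auto
  have "has Gen ((E(y := \<sigma>))(x := F x)) M \<tau>"
    using Lam.hyps(4) by (rule has_agree) (use Lam.prems(2) y(1) in auto)
  moreover have "has Gen (E(y := \<sigma>)) B (F x)"
    using Lam.prems(3) y(2) by (simp add: has_upd_fresh)
  moreover have "(fv M - {x}) \<inter> fv B = {}" using Lam.prems(5) y(2) by auto
  ultimately have "has Gen (E(y := \<sigma>)) (M[x ::= B]) \<tau>" using y(3) by (blast intro: has_cut)
  then show ?case
    using y Lam.hyps(3) by (simp add: Lam_subst fv_subst has.Lam)
qed auto

text \<open>Each case distinction in the typing of \<open>A\<close> survives the substitution,
  unless it is on \<open>x\<close> itself and would become one on \<open>B\<close>.\<close>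

lemma has_Val_subst:
  "has m F A \<rho> \<Longrightarrow> m = Val \<Longrightarrow> (\<And>v. v \<in> fv A - {x} \<Longrightarrow> E v = F v) \<Longrightarrow> has Dir E B (F x) \<Longrightarrow>
    x \<in> fv A \<Longrightarrow> (fv A - {x}) \<inter> fv B = {} \<Longrightarrow> has Val E (A[x ::= B]) \<rho>"
proof (induction x m F A \<rho> arbitrary: E rule: has_fresh_induct[where A = "\<lambda>x. insert x (fv B)"])
  case (Leaf x F A \<rho>)
  show ?case
    by (rule has.Leaf, rule has_Dir_subst[OF Leaf.hyps refl _ has_Dir_imp_Gen[OF Leaf.prems(3) refl]])
      (use Leaf.prems in auto)
next
  case (UnionE x m F A C y \<sigma> \<tau> \<theta> \<rho>)
  have m: "m = Val" by (rule UnionE.prems(1))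
  have y: "y \<noteq> x" "y \<notin> fv B" using UnionE.hyps(3) by auto
  have fv: "fv (A[y ::= C]) = fv A - {y} \<union> fv C" using UnionE.hyps(5) by (rule fv_subst)
  have nAbs: "\<not> is_Abs C" using UnionE.hyps(2) m by simp
  show ?case
  proof (cases "x \<in> fv A")
    case True
    then have xC: "x \<notin> fv C" using UnionE.hyps(6) y by auto
    have *: "\<And>v. v \<in> fv A - {x} \<Longrightarrow> (E(y := \<nu>)) v = (F(y := \<nu>)) v"
      "has Dir (E(y := \<nu>)) B ((F(y := \<nu>)) x)" for \<nu>
      using UnionE.prems(2,3) fv y by (auto simp: has_upd_fresh)
    have disj: "(fv A - {x}) \<inter> fv B = {}" using UnionE.prems(5) fv y by auto
    have fv': "fv (A[x ::= B]) = fv A - {x} \<union> fv B" using True by (rule fv_subst)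
    have BC: "fv B \<inter> fv C = {}" using UnionE.prems(5) fv xC by auto
    have "has Val E (A[x ::= B][y ::= C]) \<rho>"
    proof (rule has.UnionE)
      show "has Val (E(y := Inter \<sigma> \<theta>)) (A[x ::= B]) \<rho>" using m * True disj by (rule UnionE.IH(1))
      show "has Val (E(y := Inter \<tau> \<theta>)) (A[x ::= B]) \<rho>" using m * True disj by (rule UnionE.IH(2))
      show "has Gen E C (Inter (Union \<sigma> \<tau>) \<theta>)"
        using UnionE.hyps(9) by (rule has_agree) (use UnionE.prems(2) fv xC in auto)
      show "y \<in> fv (A[x ::= B])" using fv' UnionE.hyps(5) y by auto
      show "(fv (A[x ::= B]) - {y}) \<inter> fv C = {}"
        using UnionE.hyps(6) BC fv' by auto
    qed (use nAbs in auto)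
    then show ?thesis using subst_subst[OF y, of A C] xC by (simp add: subst_fresh)
  next
    case False
    then have xC: "x \<in> fv C" using UnionE.prems(4) fv by auto
    have eq: "A[y ::= C][x ::= B] = A[y ::= C[x ::= B]]" using False by (rule subst_compose)
    have agree: "E v = F v" if "v \<in> fv A - {y}" for v
      using that UnionE.prems(2) fv False by auto
    show ?thesis
    proof (cases "C = FVar x")
      \<comment> \<open>\<open>B\<close> might be an abstraction, on which \<open>Val\<close>
        forbids case distinctions; but it has one side of the union directly, so one branch
        suffices.\<close>
      case True
      have "has Dir E B (Inter (Union \<sigma> \<tau>) \<theta>)"
        using UnionE.hyps(9) True UnionE.prems(3) by (rule has_Dir_mono)
      then consider "has Dir E B (Inter \<sigma> \<theta>)" | "has Dir E B (Inter \<tau> \<theta>)" by auto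
      then have "has Val E (A[y ::= B]) \<rho>"
      proof cases
        case 1
        show ?thesis
          by (rule UnionE.IH(1)[OF m]) (use 1 agree UnionE.hyps(5) UnionE.prems(5) fv False in auto)
      next
        case 2
        show ?thesis
          by (rule UnionE.IH(2)[OF m]) (use 2 agree UnionE.hyps(5) UnionE.prems(5) fv False in auto)
      qed
      then show ?thesis using eq True by simp
    next
      case nVar: False
      have "has Gen (E(x := F x)) C (Inter (Union \<sigma> \<tau>) \<theta>)"
        using UnionE.hyps(9) by (rule has_agree) (use UnionE.prems(2) fv in auto)
      moreover have "(fv C - {x}) \<inter> fv B = {}" using UnionE.prems(5) fv by auto
      ultimately have C: "has Gen E (C[x ::= B]) (Inter (Union \<sigma> \<tau>) \<theta>)"
        using has_Dir_imp_Gen[OF UnionE.prems(3) refl] xC by (blast intro: has_cut)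
      have A: "has Val (E(y := \<nu>)) A \<rho>" if "has m (F(y := \<nu>)) A \<rho>" for \<nu>
        using that unfolding m by (rule has_agree) (use agree in auto)
      have "fv (C[x ::= B]) = fv C - {x} \<union> fv B" using xC by (rule fv_subst)
      then have "(fv A - {y}) \<inter> fv (C[x ::= B]) = {}"
        using UnionE.hyps(6) UnionE.prems(5) fv False by auto
      then show ?thesis unfolding eq
        by (intro has.UnionE[OF _ _ UnionE.hyps(5) _ A[OF UnionE.hyps(7)] A[OF UnionE.hyps(8)] C])
          (use nAbs nVar in \<open>auto simp: is_Abs_subst\<close>)
    qed
  qed
qed auto

text \<open>A commuting conversion: the case distinctions in the typing of \<open>B\<close> are
  moved outside the one on \<open>B\<close>. At a leaf the disjunction property selects a
  branch.\<close>

lemma has_Val_UnionE: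
  "has m E B \<nu> \<Longrightarrow> m = Val \<Longrightarrow> \<nu> = Inter (Union \<sigma> \<tau>) \<theta> \<Longrightarrow> x \<in> fv M \<Longrightarrow> (fv M - {x}) \<inter> fv B = {} \<Longrightarrow>
    has Val (E(x := Inter \<sigma> \<theta>)) M \<rho> \<Longrightarrow> has Val (E(x := Inter \<tau> \<theta>)) M \<rho> \<Longrightarrow> has Val E (M[x ::= B]) \<rho>"
proof (induction x m E B \<nu> rule: has_fresh_induct[where A = "\<lambda>x. insert x (fv M)"])
  case (Leaf x E B \<nu>)
  then consider "has Dir E B (Inter \<sigma> \<theta>)" | "has Dir E B (Inter \<tau> \<theta>)" by auto
  then show ?case
  proof cases
    case 1
    show ?thesis by (rule has_Val_subst[OF Leaf.prems(5) refl]) (use 1 Leaf.prems(3,4) in auto)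
  next
    case 2
    show ?thesis by (rule has_Val_subst[OF Leaf.prems(6) refl]) (use 2 Leaf.prems(3,4) in auto)
  qed
next
  case (UnionE x m E B C y \<sigma>' \<tau>' \<theta>' \<nu>)
  have m: "m = Val" by (rule UnionE.prems(1))
  have y: "y \<noteq> x" "y \<notin> fv M" using UnionE.hyps(3) by auto
  have fv: "fv (B[y ::= C]) = fv B - {y} \<union> fv C" using UnionE.hyps(5) by (rule fv_subst)
  have fv': "fv (M[x ::= B]) = fv M - {x} \<union> fv B" using UnionE.prems(3) by (rule fv_subst)
  have disj: "(fv M - {x}) \<inter> fv B = {}" using UnionE.prems(4) fv y by auto
  have upd: "has Val (E(y := \<kappa>, x := \<kappa>')) M \<rho>" if "has Val (E(x := \<kappa>')) M \<rho>" for \<kappa> \<kappa>'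
    using that by (rule has_agree) (use y in auto)
  note M = upd[OF UnionE.prems(5)] upd[OF UnionE.prems(6)]
  have "has Val E (M[x ::= B][y ::= C]) \<rho>"
  proof (rule has.UnionE)
    show "has Val (E(y := Inter \<sigma>' \<theta>')) (M[x ::= B]) \<rho>"
      using m UnionE.prems(2,3) disj M by (rule UnionE.IH(1))
    show "has Val (E(y := Inter \<tau>' \<theta>')) (M[x ::= B]) \<rho>"
      using m UnionE.prems(2,3) disj M by (rule UnionE.IH(2))
    show "has Gen E C (Inter (Union \<sigma>' \<tau>') \<theta>')" by (rule UnionE.hyps(9))
    show "y \<in> fv (M[x ::= B])" using fv' UnionE.hyps(5) by auto
    show "(fv (M[x ::= B]) - {y}) \<inter> fv C = {}"
      using fv' fv UnionE.hyps(6) UnionE.prems(4) by auto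
  qed (use UnionE.hyps(2) m in auto)
  then show ?case using y by (simp add: subst_compose)
qed auto

text \<open>For abstractions every rule of \<open>Gen\<close> is admissible in \<open>Val\<close>:
  \<open>InterI\<close> by combination, the other rules on types at the leaves, and
  \<open>UnionE\<close> on an abstraction by the commuting conversion.\<close>

lemma has_Gen_imp_Val: "has m E N \<sigma> \<Longrightarrow> m = Gen \<Longrightarrow> is_Abs N \<Longrightarrow> has Val E N \<sigma>"
proof (induction rule: has.induct)
  case (Lam m x M E \<sigma> \<tau>)
  then show ?case by (blast intro: has.Leaf has.Lam)
next
  case (InterI m E M \<sigma> \<tau>)
  then show ?case by (blast intro: has_Val_Inter)
next
  case (InterE1 E M \<sigma> \<tau>)
  show ?case by (rule has_Val_mono[OF InterE1.IH]) (use InterE1.prems in auto)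
next
  case (InterE2 E M \<sigma> \<tau>)
  show ?case by (rule has_Val_mono[OF InterE2.IH]) (use InterE2.prems in auto)
next
  case (UnionI1 m E M \<sigma> \<tau>)
  show ?case by (rule has_Val_mono[OF UnionI1.IH]) (use UnionI1.prems in auto)
next
  case (UnionI2 m E M \<tau> \<sigma>)
  show ?case by (rule has_Val_mono[OF UnionI2.IH]) (use UnionI2.prems in auto)
next
  case (UnionE m N x M E \<sigma> \<theta> \<rho> \<tau>)
  show ?case
  proof (cases "M = FVar x")
    \<comment> \<open>The branches type only a variable, so they amount to subtyping, which is
      applied at the leaves of the typing of \<open>N\<close>.\<close>
    case True
    then have N: "has Val E N (Inter (Union \<sigma> \<tau>) \<theta>)" using UnionE.IH(3) UnionE.prems(2) by simp
    have "has Dir F P \<rho>" if "has Dir F P (Inter (Union \<sigma> \<tau>) \<theta>)" for F P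
      using that has_Dir_mono[OF UnionE.hyps(5) True, of F P] has_Dir_mono[OF UnionE.hyps(6) True, of F P]
      by auto
    with N show ?thesis using True by (auto intro: has_Val_mono)
  next
    case False
    then have "is_Abs M" using UnionE.prems(2) by (simp add: is_Abs_subst)
    then have M: "has Val (E(x := Inter \<sigma> \<theta>)) M \<rho>" "has Val (E(x := Inter \<tau> \<theta>)) M \<rho>"
      using UnionE.IH(1,2) UnionE.prems(1) by blast+
    show ?thesis
    proof (cases "is_Abs N")
      case True
      then have "has Val E N (Inter (Union \<sigma> \<tau>) \<theta>)" using UnionE.IH(3) by simp
      then show ?thesis using has_Val_UnionE[OF _ refl refl UnionE.hyps(3,4) M] by blast
    next
      case False
      then show ?thesis using has.UnionE[OF _ _ UnionE.hyps(3,4) M UnionE.hyps(7)] by simp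
    qed
  qed
qed auto

section \<open>Reduction\<close>

lemma beta_lterm: "M \<rightarrow>\<^sub>\<beta> N \<Longrightarrow> lterm M \<and> lterm N"
  by (induction rule: beta.induct) (auto intro: lterm.intros lterm_subst)

lemma fv_beta_subset: "M \<rightarrow>\<^sub>\<beta> N \<Longrightarrow> fv N \<subseteq> fv M"
proof (induction rule: beta.induct)
  case (beta M N x)
  then show ?case using fv_subst_subset[of M x N] by auto
qed auto

lemma beta_ren: "M \<rightarrow>\<^sub>\<beta> N \<Longrightarrow> inj f \<Longrightarrow> ren f M \<rightarrow>\<^sub>\<beta> ren f N"
  by (induction rule: beta.induct) (auto simp: ren_Lam ren_subst intro: beta.intros)

lemma beta_opn:
  assumes "lterm (Abs P)" "lterm N"
  shows "App (Abs P) N \<rightarrow>\<^sub>\<beta> opn 0 N P"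
proof -
  obtain x where x: "x \<notin> fv P" using ex_fresh finite_fv by blast
  obtain M where M: "Abs P = Lam x M" "lterm M" using Lam_cases_fresh[OF assms(1) x] .
  then have "opn 0 N P = M[x ::= N]" by (simp add: Lam_def lterm_iff_lc opn_close)
  then show ?thesis using M assms(2) by (simp add: beta.beta)
qed

text \<open>The rule \<open>xi\<close> may have used another name for the bound variable; swapping
  the names restores \<open>x\<close>.\<close>

lemma beta_Lam_cases:
  assumes "Lam x M \<rightarrow>\<^sub>\<beta> T" "lterm M"
  obtains M' where "T = Lam x M'" "M \<rightarrow>\<^sub>\<beta> M'"
  using assms(1)
proof (cases rule: beta.cases)
  case (xi P P' y)
  show ?thesis
  proof (cases "y = x")
    case True
    then show ?thesis using that xi Lam_inject[of x M P] assms(2) beta_lterm by blast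
  next
    case False
    have "fv (Lam x M) = fv (Lam y P)" using xi(1) by simp
    then have x: "x \<notin> fv P" "x \<notin> fv P'" using False fv_beta_subset[OF xi(3)] by auto
    have "ren (transpose y x) P \<rightarrow>\<^sub>\<beta> ren (transpose y x) P'" using xi(3) by (rule beta_ren) simp
    then have "P[y ::= FVar x] \<rightarrow>\<^sub>\<beta> P'[y ::= FVar x]" using x by (simp add: ren_transpose)
    moreover have "Lam x M = Lam x (P[y ::= FVar x])" using xi(1) x by (simp add: Lam_alpha)
    then have "M = P[y ::= FVar x]"
      by (rule Lam_inject) (use assms(2) beta_lterm[OF xi(3)] in \<open>auto intro: lterm_subst\<close>)
    moreover have "T = Lam x (P'[y ::= FVar x])" using xi(2) x by (simp add: Lam_alpha)
    ultimately show ?thesis using that by simp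
  qed
qed auto

section \<open>Relevant terms and preservation of free variables\<close>

primrec has_bvar :: "nat \<Rightarrow> trm \<Rightarrow> bool" where
  "has_bvar k (FVar x) \<longleftrightarrow> False"
| "has_bvar k (BVar i) \<longleftrightarrow> i = k"
| "has_bvar k (App M N) \<longleftrightarrow> has_bvar k M \<or> has_bvar k N"
| "has_bvar k (Abs M) \<longleftrightarrow> has_bvar (Suc k) M"

text \<open>No vacuous abstractions, i.e. the \<open>\<lambda>I\<close>-terms.\<close>

primrec relevant :: "trm \<Rightarrow> bool" where
  "relevant (FVar x) \<longleftrightarrow> True"
| "relevant (BVar i) \<longleftrightarrow> True"
| "relevant (App M N) \<longleftrightarrow> relevant M \<and> relevant N"
| "relevant (Abs M) \<longleftrightarrow> has_bvar 0 M \<and> relevant M"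

lemma has_bvar_close: "has_bvar j (close k x M) \<longleftrightarrow> has_bvar j M \<or> j = k \<and> x \<in> fv M"
  by (induction M arbitrary: j k) auto

lemma has_bvar_subst: "has_bvar k M \<Longrightarrow> has_bvar k (M[x ::= N])"
  by (induction M arbitrary: k) auto

lemma lc_not_has_bvar: "lc k M \<Longrightarrow> k \<le> j \<Longrightarrow> \<not> has_bvar j M"
  by (induction M arbitrary: j k) auto

lemma relevant_close [simp]: "relevant (close k x M) \<longleftrightarrow> relevant M"
  by (induction M arbitrary: k) (auto simp: has_bvar_close)

lemma relevant_subst: "relevant M \<Longrightarrow> relevant N \<Longrightarrow> relevant (M[x ::= N])"
  by (induction M) (auto intro: has_bvar_subst)

lemma relevant_Lam: "lterm M \<Longrightarrow> relevant (Lam x M) \<longleftrightarrow> x \<in> fv M \<and> relevant M"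
  using lc_not_has_bvar[of 0 M 0] by (auto simp: Lam_def has_bvar_close lterm_iff_lc)

lemma fv_subset_opn_arg: "has_bvar k P \<Longrightarrow> fv N \<subseteq> fv (opn k N P)"
  by (induction P arbitrary: k) auto

lemma has_relevant: "has m E M \<sigma> \<Longrightarrow> relevant M"
  by (induction rule: has.induct) (auto simp: relevant_Lam has_lterm intro: relevant_subst)

text \<open>Without vacuous abstractions no argument is discarded. Typing depends on this:
  \<open>Lam\<close> and \<open>UnionE\<close> require their variable to occur, and the domain of an
  environment is the set of free variables.\<close>

lemma fv_beta: "M \<rightarrow>\<^sub>\<beta> N \<Longrightarrow> relevant M \<Longrightarrow> fv N = fv M"
proof (induction rule: beta.induct)
  case (beta M N x)
  then show ?case by (auto simp: relevant_Lam fv_subst)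
next
  case (xi M M' x)
  then show ?case using beta_lterm[OF xi.hyps] by (simp add: relevant_Lam)
qed auto

text \<open>Substituting a term that is not an abstraction creates no redex.\<close>

lemma beta_subst_cases:
  "A[y ::= B] \<rightarrow>\<^sub>\<beta> T \<Longrightarrow> \<not> is_Abs B \<Longrightarrow> occs y A = 1 \<Longrightarrow> lterm A \<Longrightarrow> lterm B \<Longrightarrow>
    (\<exists>A'. A \<rightarrow>\<^sub>\<beta> A' \<and> T = A'[y ::= B]) \<or> (\<exists>B'. B \<rightarrow>\<^sub>\<beta> B' \<and> T = A[y ::= B'])"
proof (induction A arbitrary: T rule: measure_induct_rule[of size])
  case (less A)
  show ?case
  proof (cases A)
    case (FVar x)
    then show ?thesis using less.prems by (auto split: if_splits)
  next
    case (BVar i)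
    then show ?thesis using less.prems by simp
  next
    case (App A1 A2)
    have lt: "lterm A1" "lterm A2" using less.prems(4) App by auto
    have occ: "occs y A1 = 1 \<and> y \<notin> fv A2 \<or> y \<notin> fv A1 \<and> occs y A2 = 1"
      using less.prems(3) App occs_fresh[of y A1] occs_fresh[of y A2] by fastforce
    from less.prems(1) App have "App (A1[y ::= B]) (A2[y ::= B]) \<rightarrow>\<^sub>\<beta> T" by simp
    then show ?thesis
    proof (cases rule: beta.cases)
      case (beta M x)
      have "is_Abs (A1[y ::= B])" using beta by simp
      \<comment> \<open>\<open>B\<close> is not an abstraction, so the redex was present in
        \<open>A\<close> before the substitution.\<close>
      then have "is_Abs A1" using less.prems(2) by (simp add: is_Abs_subst)
      then obtain P where P: "A1 = Abs P" by (auto simp: is_Abs_def)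
      then have "P[y ::= B] = close 0 x M" using beta by (simp add: Lam_def)
      then have "opn 0 (A2[y ::= B]) (P[y ::= B]) = T"
        using beta by (simp add: opn_close lterm_iff_lc)
      then have "T = (opn 0 A2 P)[y ::= B]" using less.prems(5) by (simp add: opn_subst)
      moreover have "A \<rightarrow>\<^sub>\<beta> opn 0 A2 P" using beta_opn lt P App by simp
      ultimately show ?thesis by blast
    next
      case (appL M')
      show ?thesis
      proof (cases "y \<in> fv A1")
        case True
        then have y: "occs y A1 = 1" "y \<notin> fv A2" using occ by auto
        have "size A1 < size A" "A1[y ::= B] \<rightarrow>\<^sub>\<beta> M'" using appL App by auto
        from less.IH[OF this less.prems(2) y(1) lt(1) less.prems(5)] show ?thesis
        proof (elim disjE exE conjE)
          fix A' assume "A1 \<rightarrow>\<^sub>\<beta> A'" "M' = A'[y ::= B]"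
          then show ?thesis using App appL lt(2) y(2)
            by (intro disjI1 exI[of _ "App A' A2"]) (simp add: beta.appL)
        next
          fix B' assume "B \<rightarrow>\<^sub>\<beta> B'" "M' = A1[y ::= B']"
          then show ?thesis using App appL y(2)
            by (intro disjI2 exI[of _ B']) (simp add: subst_fresh)
        qed
      next
        case False
        then have "A1 \<rightarrow>\<^sub>\<beta> M'" using appL by (simp add: subst_fresh)
        moreover from this have "y \<notin> fv M'" using False fv_beta_subset by blast
        ultimately show ?thesis using App appL lt(2)
          by (intro disjI1 exI[of _ "App M' A2"]) (simp add: subst_fresh beta.appL)
      qed
    next
      case (appR N')
      show ?thesis
      proof (cases "y \<in> fv A2")
        case True
        then have y: "occs y A2 = 1" "y \<notin> fv A1" using occ by auto
        have "size A2 < size A" "A2[y ::= B] \<rightarrow>\<^sub>\<beta> N'" using appR App by auto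
        from less.IH[OF this less.prems(2) y(1) lt(2) less.prems(5)] show ?thesis
        proof (elim disjE exE conjE)
          fix A' assume "A2 \<rightarrow>\<^sub>\<beta> A'" "N' = A'[y ::= B]"
          then show ?thesis using App appR lt(1) y(2)
            by (intro disjI1 exI[of _ "App A1 A'"]) (simp add: beta.appR)
        next
          fix B' assume "B \<rightarrow>\<^sub>\<beta> B'" "N' = A2[y ::= B']"
          then show ?thesis using App appR y(2)
            by (intro disjI2 exI[of _ B']) (simp add: subst_fresh)
        qed
      next
        case False
        then have "A2 \<rightarrow>\<^sub>\<beta> N'" using appR by (simp add: subst_fresh)
        moreover from this have "y \<notin> fv N'" using False fv_beta_subset by blast
        ultimately show ?thesis using App appR lt(1)
          by (intro disjI1 exI[of _ "App A1 N'"]) (simp add: subst_fresh beta.appR)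
      qed
    qed simp
  next
    case (Abs P)
    obtain u where u: "u \<notin> fv P \<union> fv B \<union> {y}"
      using ex_fresh finite_fv by (metis finite.emptyI finite.insertI finite_UnI)
    then obtain A' where A': "A = Lam u A'" "lterm A'" "size A' = size P"
      using Lam_cases_fresh[of P u] less.prems(4) Abs by auto
    have sub: "A[y ::= Q] = Lam u (A'[y ::= Q])" if "u \<notin> fv Q" for Q
      using A'(1) u that by (simp add: Lam_subst)
    then have "Lam u (A'[y ::= B]) \<rightarrow>\<^sub>\<beta> T" using less.prems(1) u by simp
    then obtain T' where T': "T = Lam u T'" "A'[y ::= B] \<rightarrow>\<^sub>\<beta> T'"
      using beta_Lam_cases lterm_subst[OF A'(2) less.prems(5)] by blast
    have size: "size A' < size A" using A'(3) Abs by simp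
    have "occs y A' = 1" using less.prems(3) A'(1) u by (simp add: Lam_def)
    from less.IH[OF size T'(2) less.prems(2) this A'(2) less.prems(5)] show ?thesis
    proof (elim disjE exE conjE)
      fix A'' assume "A' \<rightarrow>\<^sub>\<beta> A''" "T' = A''[y ::= B]"
      then show ?thesis using A'(1) T'(1) u
        by (intro disjI1 exI[of _ "Lam u A''"]) (simp add: beta.xi Lam_subst)
    next
      fix B' assume B': "B \<rightarrow>\<^sub>\<beta> B'" "T' = A'[y ::= B']"
      then have "u \<notin> fv B'" using u fv_beta_subset by blast
      then show ?thesis using B' T'(1) sub[of B'] by auto
    qed
  qed
qed

section \<open>Contraction of a redex\<close>

lemma opn_FVar_subst: "u \<notin> fv P \<Longrightarrow> (opn k (FVar u) P)[u ::= N] = opn k N P"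
  by (induction P arbitrary: k) auto

lemma has_FVar_trans:
  assumes "has Gen F (FVar w) \<sigma>" "has Gen E N (F w)"
  shows "has Gen E N \<sigma>"
proof -
  have "has Gen (E(w := F w)) (FVar w) \<sigma>" using assms(1) by (rule has_agree) auto
  from has_cut[OF this assms(2)] show ?thesis by simp
qed

text \<open>The derivation for \<open>z\<close> applied to \<open>w\<close> is replayed with the
  contractum in place of the application. \<open>F\<close> matters only at \<open>z\<close> and
  \<open>w\<close>, while \<open>E\<close> types the actual function and argument. At arrow
  elimination the direct typing of \<open>Abs P\<close> ends in \<open>Lam\<close>, and a cut types
  the contractum.\<close>

lemma has_Dir_App:
  "has m F T \<rho> \<Longrightarrow> T = App (FVar z) (FVar w) \<Longrightarrow> has Dir E (Abs P) (F z) \<Longrightarrow> has Gen E N (F w) \<Longrightarrow>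
    fv P \<inter> fv N = {} \<Longrightarrow> has Gen E (opn 0 N P) \<rho>"
proof (induction arbitrary: z w E N rule: has.induct)
  case (App M M' F \<sigma> \<tau>)
  then have "has Dir E (Abs P) (Arrow \<sigma> \<tau>)" using has_Dir_mono[of Gen F M "Arrow \<sigma> \<tau>" z] by simp
  then obtain x Q where Q: "Abs P = Lam x Q" "x \<in> fv Q" "has Gen (E(x := \<sigma>)) Q \<tau>"
    by (auto elim: has_Dir_ArrowE)
  have "has Gen E N \<sigma>" using App.hyps(3) App.prems(1,3) by (auto intro: has_FVar_trans)
  moreover have "fv (Abs P) = fv (Lam x Q)" using Q(1) by (rule arg_cong)
  then have "(fv Q - {x}) \<inter> fv N = {}" using App.prems(4) by simp
  ultimately have "has Gen E (Q[x ::= N]) \<tau>" using Q by (blast intro: has_cut)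
  moreover have "opn 0 N P = Q[x ::= N]"
    using Q(1) has_lterm[OF Q(3)] by (simp add: Lam_def lterm_iff_lc opn_close)
  ultimately show ?case by simp
next
  case (InterI m F T \<sigma> \<tau>)
  from InterI.IH(1)[OF InterI.prems] InterI.IH(2)[OF InterI.prems] show ?case by (blast intro: has.InterI)
next
  case (InterE1 F T \<sigma> \<tau>)
  from InterE1.IH[OF InterE1.prems] show ?case by (rule has.InterE1)
next
  case (InterE2 F T \<sigma> \<tau>)
  from InterE2.IH[OF InterE2.prems] show ?case by (rule has.InterE2)
next
  case (UnionI1 m F T \<sigma> \<tau>)
  from UnionI1.IH[OF UnionI1.prems] show ?case by (blast intro: has.UnionI1)
next
  case (UnionI2 m F T \<sigma> \<tau>)
  from UnionI2.IH[OF UnionI2.prems] show ?case by (blast intro: has.UnionI2)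
next
  case (UnionE m B y A F \<sigma> \<theta> \<rho> \<tau>)
  have "m = Gen" using UnionE.prems(1) has_imp_is_Abs[OF UnionE.hyps(5)]
    by (cases m; cases A) auto
  note m = UnionE.hyps(5,6)[unfolded this]
  have occ: "occs y A = 1" using UnionE.hyps(5,3) by (rule has_occs)
  show ?case
  proof (cases A)
    \<comment> \<open>Cases on the whole application become cases on the contractum.\<close>
    case (FVar v)
    then have A: "A = FVar y" "B = App (FVar z) (FVar w)"
      using UnionE.hyps(3) UnionE.prems(1) by auto
    have "has Gen (E(y := \<nu>)) (FVar y) \<rho>" if "has Gen (F(y := \<nu>)) A \<rho>" for \<nu>
      using that unfolding A(1) by (rule has_agree) auto
    then have "has Gen E ((FVar y)[y ::= opn 0 N P]) \<rho>"
      using m UnionE.IH(3)[OF A(2) UnionE.prems(2-4)]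
      by (intro has.UnionE[where \<sigma> = \<sigma> and \<tau> = \<tau> and \<theta> = \<theta>]) auto
    then show ?thesis by simp
  next
    case (App A1 A2)
    then have eq: "A1[y ::= B] = FVar z" "A2[y ::= B] = FVar w" using UnionE.prems(1) by auto
    have "occs y A1 \<noteq> 0 \<and> occs y A2 = 0 \<or> occs y A1 = 0 \<and> occs y A2 \<noteq> 0"
      using occ App by auto
    then consider "y \<in> fv A1" "y \<notin> fv A2" | "y \<notin> fv A1" "y \<in> fv A2"
      unfolding occs_fresh by blast
    then show ?thesis
    proof cases
      \<comment> \<open>Cases on the function: its direct typing has one side of the union, so one
        branch suffices.\<close>
      case 1
      then have A: "A1 = FVar y" "B = FVar z" "A2 = FVar w" "w \<noteq> y"
        using subst_eq_FVar[OF eq(1) 1(1)] eq(2) 1(2) subst_fresh[OF 1(2), of B] by auto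
      then have A': "A = App (FVar y) (FVar w)" using App by simp
      have "has Dir E (Abs P) (Inter (Union \<sigma> \<tau>) \<theta>)"
        using UnionE.hyps(7) A(2) UnionE.prems(2) by (rule has_Dir_mono)
      then have "has Dir E (Abs P) (Inter \<sigma> \<theta>) \<or> has Dir E (Abs P) (Inter \<tau> \<theta>)" by auto
      then show ?thesis
        using UnionE.IH(1,2)[OF A', of E N] UnionE.prems(3,4) A(4) by auto
    next
      \<comment> \<open>Cases on the argument are kept, with a fresh \<open>u\<close> standing for
        \<open>N\<close>. The abstraction is not vacuous, so \<open>u\<close> occurs as
        \<open>UnionE\<close> demands.\<close>
      case 2
      then have A: "A2 = FVar y" "B = FVar w" "A1 = FVar z" "z \<noteq> y"
        using subst_eq_FVar[OF eq(2) 2(2)] eq(1) 2(1) subst_fresh[OF 2(1), of B] by auto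
      then have A': "A = App (FVar z) (FVar y)" using App by simp
      have N: "has Gen E N (Inter (Union \<sigma> \<tau>) \<theta>)"
        using UnionE.hyps(7) UnionE.prems(3) unfolding A(2) by (rule has_FVar_trans)
      obtain u where u: "u \<notin> fv P" using ex_fresh finite_fv by blast
      have D: "has Dir (E(u := \<nu>)) (Abs P) (F z)" for \<nu>
        using UnionE.prems(2) u by (simp add: has_upd_fresh)
      have "has Gen (E(u := Inter \<sigma> \<theta>)) (opn 0 (FVar u) P) \<rho>"
        by (rule UnionE.IH(1)[OF A']) (use D[of "Inter \<sigma> \<theta>"] has_Var_upd[of E u "Inter \<sigma> \<theta>"] A(4) u
            in \<open>simp_all add: fun_upd_def\<close>)
      moreover have "has Gen (E(u := Inter \<tau> \<theta>)) (opn 0 (FVar u) P) \<rho>"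
        by (rule UnionE.IH(2)[OF A']) (use D[of "Inter \<tau> \<theta>"] has_Var_upd[of E u "Inter \<tau> \<theta>"] A(4) u
            in \<open>simp_all add: fun_upd_def\<close>)
      moreover have "has_bvar 0 P" using has_relevant[OF UnionE.prems(2)] by simp
      then have "u \<in> fv (opn 0 (FVar u) P)" using fv_subset_opn_arg[of 0 P "FVar u"] by simp
      moreover have "(fv (opn 0 (FVar u) P) - {u}) \<inter> fv N = {}"
        using fv_opn_subset[of 0 "FVar u" P] UnionE.prems(4) by auto
      ultimately have "has Gen E ((opn 0 (FVar u) P)[u ::= N]) \<rho>"
        using N by (intro has.UnionE[where \<sigma> = \<sigma> and \<tau> = \<tau> and \<theta> = \<theta>]) auto
      then show ?thesis using u by (simp add: opn_FVar_subst)
    qed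
  qed (use UnionE.prems(1) in auto)
qed auto

text \<open>Case distinctions in the typing of the function are made on the contractum instead;
  freshness of \<open>y\<close> for \<open>N\<close> lets the substitution of \<open>B\<close> pass
  through the contraction.\<close>

lemma has_Val_App:
  "has m E L \<tau> \<Longrightarrow> m = Val \<Longrightarrow> L = Abs P \<Longrightarrow> has Gen F (App (FVar z) (FVar w)) \<rho> \<Longrightarrow> F z = \<tau> \<Longrightarrow>
    has Gen E N (F w) \<Longrightarrow> fv P \<inter> fv N = {} \<Longrightarrow> has Gen E (opn 0 N P) \<rho>"
proof (induction z m E L \<tau> arbitrary: P rule: has_fresh_induct[where A = "\<lambda>_. fv N"])
  case (Leaf z E L \<tau>)
  have "has Dir E (Abs P) (F z)" using Leaf.hyps Leaf.prems(2,4) by simp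
  from has_Dir_App[OF Leaf.prems(3) refl this Leaf.prems(5,6)] show ?case .
next
  case (UnionE z m E A B y \<sigma> \<tau> \<theta> \<nu>)
  have "is_Abs A" using has_imp_is_Abs[OF UnionE.hyps(7)] UnionE.prems(1) by simp
  then obtain Q where Q: "A = Abs Q" by (auto simp: is_Abs_def)
  then have P: "P = Q[y ::= B]" using UnionE.prems(2) by simp
  have fv: "fv P = fv Q - {y} \<union> fv B" using UnionE.hyps(5) Q P by (simp add: fv_subst)
  have N: "has Gen (E(y := \<kappa>)) N (F w)" for \<kappa>
    using UnionE.prems(5) UnionE.hyps(3) by (simp add: has_upd_fresh)
  have disj: "fv Q \<inter> fv N = {}" using UnionE.prems(6) UnionE.hyps(3) fv by auto
  have 1: "has Gen (E(y := Inter \<sigma> \<theta>)) (opn 0 N Q) \<rho>"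
    using UnionE.prems(1) Q UnionE.prems(3,4) N disj by (rule UnionE.IH(1))
  have 2: "has Gen (E(y := Inter \<tau> \<theta>)) (opn 0 N Q) \<rho>"
    using UnionE.prems(1) Q UnionE.prems(3,4) N disj by (rule UnionE.IH(2))
  have y: "y \<in> fv (opn 0 N Q)" using fv_subset_opn[of Q 0 N] UnionE.hyps(5) Q by auto
  have "fv B \<inter> fv N = {}" using UnionE.prems(6) fv by auto
  moreover have "(fv Q - {y}) \<inter> fv B = {}" using UnionE.hyps(6) Q by simp
  ultimately have "(fv (opn 0 N Q) - {y}) \<inter> fv B = {}" using fv_opn_subset[of 0 N Q] by auto
  then have "has Gen E ((opn 0 N Q)[y ::= B]) \<rho>"
    by (intro has.UnionE[OF _ _ y _ 1 2 UnionE.hyps(9)]) auto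
  moreover have "(opn 0 N Q)[y ::= B] = opn 0 (N[y ::= B]) P"
    using P has_lterm[OF UnionE.hyps(9)] by (simp add: opn_subst)
  moreover have "N[y ::= B] = N" using UnionE.hyps(3) by (rule subst_fresh)
  ultimately show ?case by simp
qed auto

text \<open>Counting occurrences avoids inverting the typing, which may end in a case
  distinction.\<close>

lemma has_App_disjoint:
  assumes "has m E (App M N) \<sigma>"
  shows "fv M \<inter> fv N = {}"
proof (rule ccontr)
  assume "\<not> ?thesis"
  then obtain x where x: "x \<in> fv M" "x \<in> fv N" by blast
  then have "occs x M + occs x N = 1" using has_occs[OF assms, of x] by simp
  then have "occs x M = 0 \<or> occs x N = 0" by linarith
  then show False using x by (simp add: occs_fresh)
qed

text \<open>Interpolation replaces the inversion of application typings: the function receives a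
  single type, which need not be an arrow.\<close>

lemma has_App_fun:
  assumes "has Gen E (App M N) \<rho>" "z \<notin> fv M" "z \<notin> fv N"
  obtains \<tau> where "has Gen E M \<tau>" "has Gen (E(z := \<tau>)) (App (FVar z) N) \<rho>"
proof -
  have "App M N = (App (FVar z) N)[z ::= M]" using assms(3) by (simp add: subst_fresh)
  moreover have "occs z (App (FVar z) N) = 1" using assms(3) by (simp add: occs_fresh)
  ultimately show ?thesis
    using has_interpolation[OF assms(1), of "App (FVar z) N" z M] assms has_lterm[OF assms(1)] that
    by auto
qed

lemma has_App_arg:
  assumes "has Gen E (App M N) \<rho>" "z \<notin> fv M" "z \<notin> fv N"
  obtains \<tau> where "has Gen E N \<tau>" "has Gen (E(z := \<tau>)) (App M (FVar z)) \<rho>"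
proof -
  have "App M N = (App M (FVar z))[z ::= N]" using assms(2) by (simp add: subst_fresh)
  moreover have "occs z (App M (FVar z)) = 1" using assms(2) by (simp add: occs_fresh)
  ultimately show ?thesis
    using has_interpolation[OF assms(1), of "App M (FVar z)" z N] assms has_lterm[OF assms(1)] that
    by auto
qed

text \<open>Two interpolations reduce the redex to \<open>z\<close> applied to \<open>w\<close>.
  Whatever type \<tau> the abstraction receives there, it also has it in mode
  \<open>Val\<close>.\<close>

lemma has_redex:
  assumes "has Gen E (App (Abs P) N) \<rho>"
  shows "has Gen E (opn 0 N P) \<rho>"
proof -
  obtain z where z: "z \<notin> fv P" "z \<notin> fv N" using ex_fresh[of "fv P \<union> fv N"] by auto
  then obtain \<tau> where \<tau>: "has Gen E (Abs P) \<tau>" "has Gen (E(z := \<tau>)) (App (FVar z) N) \<rho>"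
    using has_App_fun[OF assms] by auto
  obtain w where w: "w \<noteq> z" "w \<notin> fv N" using ex_fresh[of "insert z (fv N)"] by auto
  then obtain \<nu> where \<nu>: "has Gen (E(z := \<tau>)) N \<nu>"
    "has Gen (E(z := \<tau>, w := \<nu>)) (App (FVar z) (FVar w)) \<rho>"
    using has_App_arg[OF \<tau>(2)] by auto
  have "has Gen E N \<nu>" using \<nu>(1) z by (simp add: has_upd_fresh)
  moreover have "fv P \<inter> fv N = {}" using has_App_disjoint[OF assms] by simp
  moreover have "has Val E (Abs P) \<tau>" using \<tau>(1) by (rule has_Gen_imp_Val) auto
  ultimately show ?thesis using has_Val_App[OF _ refl refl \<nu>(2)] w(1) by simp
qed

section \<open>Reduction inside a term\<close>

lemma size_subst_less: "x \<in> fv M \<Longrightarrow> M \<noteq> FVar x \<Longrightarrow> size N < size (M[x ::= N])"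
  using size_subst_ge[of x _ N] by (cases M) (auto simp: less_Suc_eq_le intro: le_trans trans_le_add1 trans_le_add2)

lemma size_close [simp]: "size (close k x M) = size M"
  by (induction M arbitrary: k) auto

lemma size_Lam [simp]: "size (Lam x M) = Suc (size M)"
  by (simp add: Lam_def)

text \<open>In these modes cases are distinguished on non-abstractions only, so a step lies either
  in a branch or in the term under case distinction, and finally in the body of an abstraction. The
  hypothesis on smaller terms covers bodies and terms under case distinction.\<close>

lemma has_beta_Abs:
  fixes E :: "name \<Rightarrow> 'a ty"
  assumes "has m E T \<rho>" "m \<noteq> Gen" "T \<rightarrow>\<^sub>\<beta> T'"
    and "\<And>(F :: name \<Rightarrow> 'a ty) Q \<sigma> Q'. size Q < size T \<Longrightarrow> has Gen F Q \<sigma> \<Longrightarrow> Q \<rightarrow>\<^sub>\<beta> Q' \<Longrightarrow> has Gen F Q' \<sigma>"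
  shows "has Gen E T' \<rho>"
  using assms
proof (induction arbitrary: T' rule: has.induct)
  case (Lam m x M E \<sigma> \<tau>)
  obtain M' where M': "T' = Lam x M'" "M \<rightarrow>\<^sub>\<beta> M'"
    using beta_Lam_cases[OF Lam.prems(2) has_lterm[OF Lam.hyps(3)]] .
  have "has Gen (E(x := \<sigma>)) M' \<tau>"
    by (rule Lam.prems(3)[OF _ Lam.hyps(3) M'(2)]) simp
  moreover have "x \<in> fv M'" using fv_beta[OF M'(2)] has_relevant[OF Lam.hyps(3)] Lam.hyps(2) by simp
  ultimately show ?case unfolding M'(1) by (intro has.Lam) auto
next
  case (UnionE m B y A E \<sigma> \<theta> \<rho> \<tau>)
  have A: "is_Abs A" using has_imp_is_Abs[OF UnionE.hyps(5)] UnionE.prems(1) .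
  have m: "m = Val" using UnionE.hyps(1) UnionE.prems(1) by (cases m) auto
  have occ: "occs y A = 1" using UnionE.hyps(5,3) by (rule has_occs)
  \<comment> \<open>Substitution does not shrink \<open>A\<close>, so the branches inherit the
    hypothesis on smaller terms.\<close>
  have size: "size Q < size (A[y ::= B])" if "size Q < size A" for Q :: trm
    using that size_subst[of A y B] by linarith
  note IH = UnionE.IH(1,2)[OF UnionE.prems(1) _ UnionE.prems(3)[OF size]]
  note gen = has_Val_imp_Gen[OF UnionE.hyps(5)[unfolded m] refl] has_Val_imp_Gen[OF UnionE.hyps(6)[unfolded m] refl]
  from beta_subst_cases[OF UnionE.prems(2) UnionE.hyps(2)[OF m] occ
      has_lterm[OF UnionE.hyps(5)] has_lterm[OF UnionE.hyps(7)]]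
  show ?case
  proof (elim disjE exE conjE)
    fix A' assume A': "A \<rightarrow>\<^sub>\<beta> A'" "T' = A'[y ::= B]"
    have fv: "fv A' = fv A" using fv_beta[OF A'(1)] has_relevant[OF UnionE.hyps(5)] .
    have "has Gen E (A'[y ::= B]) \<rho>"
      by (rule has.UnionE[OF _ _ _ _ IH(1)[OF A'(1)] IH(2)[OF A'(1)] UnionE.hyps(7)])
        (use fv UnionE.hyps(3,4) in auto)
    then show ?thesis using A'(2) by simp
  next
    fix B' assume B': "B \<rightarrow>\<^sub>\<beta> B'" "T' = A[y ::= B']"
    \<comment> \<open>\<open>A\<close> is an abstraction and hence not the variable
      \<open>y\<close>, so \<open>B\<close> is strictly smaller.\<close>
    have "size B < size (A[y ::= B])" using A UnionE.hyps(3) by (intro size_subst_less) auto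
    then have *: "has Gen E B' (Inter (Union \<sigma> \<tau>) \<theta>)"
      using UnionE.hyps(7) B'(1) by (rule UnionE.prems(3))
    have "has Gen E (A[y ::= B']) \<rho>"
      by (rule has.UnionE[OF _ _ UnionE.hyps(3) _ gen *])
        (use fv_beta_subset[OF B'(1)] UnionE.hyps(4) in auto)
    then show ?thesis using B'(2) by simp
  qed
qed (auto intro: has.InterI has.UnionI1 has.UnionI2)

text \<open>Size induction, because for a step under a binder \<open>has_beta_Abs\<close> needs the
  claim also for the terms on which the normal typing distinguishes cases.\<close>

lemma has_beta: "has Gen E T \<rho> \<Longrightarrow> T \<rightarrow>\<^sub>\<beta> T' \<Longrightarrow> has Gen E T' \<rho>"
proof (induction T arbitrary: E \<rho> T' rule: measure_induct_rule[of size])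
  case (less T)
  from less.prems(2) show ?case
  proof (cases rule: beta.cases)
    case (beta M N x)
    have "has Gen E (opn 0 N (close 0 x M)) \<rho>"
      using less.prems(1) beta(1) by (intro has_redex) (simp add: Lam_def)
    then show ?thesis using beta by (simp add: lterm_iff_lc opn_close)
  next
    case (appL M M' N)
    obtain z where z: "z \<notin> fv M" "z \<notin> fv N" using ex_fresh[of "fv M \<union> fv N"] by auto
    have MN: "has Gen E (App M N) \<rho>" using less.prems(1) appL(1) by simp
    from has_App_fun[OF this z] obtain \<tau> where
      \<tau>: "has Gen E M \<tau>" "has Gen (E(z := \<tau>)) (App (FVar z) N) \<rho>" .
    \<comment> \<open>The reduct keeps the interpolant \<tau> and a cut restores the application,
      whatever the shape of \<tau>.\<close>
    have "has Gen E M' \<tau>" using less.IH[of M] appL \<tau>(1) by simp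
    then have "has Gen E ((App (FVar z) N)[z ::= M']) \<rho>"
      by (rule has_cut[OF \<tau>(2)]) (use has_App_disjoint[OF MN] fv_beta_subset[of M M'] appL in auto)
    then show ?thesis using appL(2) z by (simp add: subst_fresh)
  next
    case (appR M N N')
    obtain z where z: "z \<notin> fv M" "z \<notin> fv N" using ex_fresh[of "fv M \<union> fv N"] by auto
    have MN: "has Gen E (App M N) \<rho>" using less.prems(1) appR(1) by simp
    from has_App_arg[OF this z] obtain \<tau> where
      \<tau>: "has Gen E N \<tau>" "has Gen (E(z := \<tau>)) (App M (FVar z)) \<rho>" .
    have "has Gen E N' \<tau>" using less.IH[of N] appR \<tau>(1) by simp
    then have "has Gen E ((App M (FVar z))[z ::= N']) \<rho>"
      by (rule has_cut[OF \<tau>(2)]) (use has_App_disjoint[OF MN] fv_beta_subset[of N N'] appR in auto)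
    then show ?thesis using appR(2) z by (simp add: subst_fresh)
  next
    case (xi M M' x)
    have "has Val E T \<rho>" using less.prems(1) xi(1) by (intro has_Gen_imp_Val) auto
    then show ?thesis by (rule has_beta_Abs) (use less in auto)
  qed
qed

section \<open>Subject reduction\<close>

lemma dom_typing: "\<Gamma> \<turnstile> M \<^bold>: \<sigma> \<Longrightarrow> dom \<Gamma> = fv M"
proof (induction rule: typing.induct)
  case (Ax x \<sigma>)
  show ?case by (simp del: fun_upd_apply)
next
  case (ArrI \<Gamma> x \<sigma> M \<tau>)
  then have "insert x (dom \<Gamma>) = fv M" by (simp del: fun_upd_apply)
  then show ?case using ArrI.hyps(1) by auto
next
  case (UnionE \<Gamma>\<^sub>1 \<Gamma>\<^sub>2 x \<sigma> \<theta> M \<rho> \<tau> N)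
  then have "insert x (dom \<Gamma>\<^sub>1) = fv M" by (simp del: fun_upd_apply)
  then have "x \<in> fv M" "dom \<Gamma>\<^sub>1 = fv M - {x}" using UnionE.hyps(2) by auto
  then show ?case using UnionE.IH(3) by (simp add: fv_subst Un_commute)
qed auto

text \<open>One total \<open>E\<close> extends both disjoint environments of a rule, so nothing has
  to be split.\<close>

lemma typing_imp_has: "\<Gamma> \<turnstile> M \<^bold>: \<sigma> \<Longrightarrow> \<Gamma> \<subseteq>\<^sub>m (\<lambda>x. Some (E x)) \<Longrightarrow> has Gen E M \<sigma>"
proof (induction arbitrary: E rule: typing.induct)
  case (Ax x \<sigma>)
  then have "[x \<mapsto> \<sigma>] x = Some (E x)" unfolding map_le_def by (rule bspec[where x = x]) simp
  then show ?case using has.Var[of E x] by simp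
next
  case (ArrI \<Gamma> x \<sigma> M \<tau>)
  have "x \<in> fv M" using dom_typing[OF ArrI.hyps(2)] by auto
  moreover have "has Gen (E(x := \<sigma>)) M \<tau>"
    by (rule ArrI.IH) (use ArrI.prems ArrI.hyps(1) in \<open>auto simp: map_le_def\<close>)
  ultimately show ?case by (auto intro: has.Lam)
next
  case (ArrE \<Gamma>\<^sub>1 \<Gamma>\<^sub>2 M \<sigma> \<tau> N)
  have "fv M \<inter> fv N = {}" using ArrE.hyps(1) dom_typing[OF ArrE.hyps(2)] dom_typing[OF ArrE.hyps(3)] by simp
  moreover have "\<Gamma>\<^sub>1 \<subseteq>\<^sub>m (\<lambda>x. Some (E x))" "\<Gamma>\<^sub>2 \<subseteq>\<^sub>m (\<lambda>x. Some (E x))"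
    using ArrE.prems ArrE.hyps(1) by (auto simp: map_le_def map_add_dom_app_simps Int_def)
  ultimately show ?case using ArrE.IH by (blast intro: has.App)
next
  case (InterI \<Gamma> M \<sigma> \<tau>)
  then show ?case by (blast intro: has.InterI)
next
  case (InterE1 \<Gamma> M \<sigma> \<tau>)
  then show ?case by (blast intro: has.InterE1)
next
  case (InterE2 \<Gamma> M \<sigma> \<tau>)
  then show ?case by (blast intro: has.InterE2)
next
  case (UnionI1 \<Gamma> M \<sigma> \<tau>)
  then show ?case by (blast intro: has.UnionI1)
next
  case (UnionI2 \<Gamma> M \<sigma> \<tau>)
  then show ?case by (blast intro: has.UnionI2)
next
  case (UnionE \<Gamma>\<^sub>1 \<Gamma>\<^sub>2 x \<sigma> \<theta> M \<rho> \<tau> N)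
  have x: "x \<in> fv M" "fv M - {x} = dom \<Gamma>\<^sub>1"
    using dom_typing[OF UnionE.hyps(3)] UnionE.hyps(2) by (auto simp: domIff)
  have \<Gamma>: "\<Gamma>\<^sub>1 \<subseteq>\<^sub>m (\<lambda>x. Some (E x))" "\<Gamma>\<^sub>2 \<subseteq>\<^sub>m (\<lambda>x. Some (E x))"
    using UnionE.prems UnionE.hyps(1) by (auto simp: map_le_def map_add_dom_app_simps Int_def)
  then have upd: "\<Gamma>\<^sub>1(x \<mapsto> \<nu>) \<subseteq>\<^sub>m (\<lambda>v. Some ((E(x := \<nu>)) v))" for \<nu>
    by (auto simp: map_le_def)
  show ?case
    by (rule has.UnionE[OF _ _ x(1) _ UnionE.IH(1)[OF upd] UnionE.IH(2)[OF upd] UnionE.IH(3)[OF \<Gamma>(2)]])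
      (use x(2) UnionE.hyps(1) dom_typing[OF UnionE.hyps(5)] in auto)
qed

definition env_on :: "(name \<Rightarrow> 'a ty) \<Rightarrow> name set \<Rightarrow> 'a env" where
  "env_on E X = (\<lambda>x. if x \<in> X then Some (E x) else None)"

lemma dom_env_on [simp]: "dom (env_on E X) = X"
  by (auto simp: env_on_def split: if_splits)

lemma env_on_upd: "x \<in> X \<Longrightarrow> (env_on E (X - {x}))(x \<mapsto> \<sigma>) = env_on (E(x := \<sigma>)) X"
  by (auto simp: env_on_def)

lemma env_on_Un: "env_on E X ++ env_on E Y = env_on E (X \<union> Y)"
  by (auto simp: env_on_def map_add_def)

lemma has_imp_typing: "has m E M \<sigma> \<Longrightarrow> m = Gen \<Longrightarrow> env_on E (fv M) \<turnstile> M \<^bold>: \<sigma>"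
proof (induction rule: has.induct)
  case (Var E x)
  have "env_on E {x} = [x \<mapsto> E x]" by (auto simp: env_on_def)
  then show ?case unfolding fv.simps by (simp only: typing.Ax)
next
  case (Lam m x M E \<sigma> \<tau>)
  then have "(env_on E (fv (Lam x M)))(x \<mapsto> \<sigma>) \<turnstile> M \<^bold>: \<tau>"
    by (simp add: env_on_upd del: fun_upd_apply)
  moreover have "env_on E (fv (Lam x M)) x = None" by (simp add: env_on_def)
  ultimately show ?case by (blast intro: typing.ArrI)
next
  case (InterE1 E M \<sigma> \<tau>)
  then show ?case by (blast intro: typing.InterE1)
next
  case (InterE2 E M \<sigma> \<tau>)
  then show ?case by (blast intro: typing.InterE2)
next
  case (App M N E \<sigma> \<tau>)
  then show ?case using typing.ArrE[of "env_on E (fv M)" "env_on E (fv N)" M \<sigma> \<tau> N] by (simp add: env_on_Un)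
next
  case (UnionE m N x M E \<sigma> \<theta> \<rho> \<tau>)
  have "env_on E (fv M - {x}) ++ env_on E (fv N) \<turnstile> M[x ::= N] \<^bold>: \<rho>"
  proof (rule typing.UnionE)
    show "(env_on E (fv M - {x}))(x \<mapsto> Inter \<sigma> \<theta>) \<turnstile> M \<^bold>: \<rho>"
      "(env_on E (fv M - {x}))(x \<mapsto> Inter \<tau> \<theta>) \<turnstile> M \<^bold>: \<rho>"
      using UnionE by (simp_all add: env_on_upd del: fun_upd_apply)
    show "env_on E (fv N) \<turnstile> N \<^bold>: Inter (Union \<sigma> \<tau>) \<theta>" using UnionE by simp
    show "env_on E (fv M - {x}) x = None" by (simp add: env_on_def)
  qed (simp add: UnionE.hyps(4))
  then show ?case using UnionE.hyps by (simp add: env_on_Un fv_subst)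
qed (auto intro: typing.InterI typing.UnionI1 typing.UnionI2)

theorem mainTheorem7:
  fixes M N :: trm and \<Gamma> :: "'a env" and \<sigma> :: "'a ty"
  assumes "linear_lterm M"
    and "\<Gamma> \<turnstile> M \<^bold>: \<sigma>"
    and "M \<rightarrow>\<^sub>\<beta>\<^sup>* N"
  shows "\<Gamma> \<turnstile> N \<^bold>: \<sigma>"
proof -
  \<comment> \<open>Outside the domain of \<Gamma> the value is arbitrary, but these names are not
    free in \<open>M\<close>.\<close>
  define E where "E x = the (\<Gamma> x)" for x
  have \<Gamma>: "\<Gamma> = env_on E (fv M)"
    unfolding dom_typing[OF assms(2), symmetric] by (rule ext) (auto simp: env_on_def E_def domIff)
  have "has Gen E M \<sigma>"
    using assms(2) by (rule typing_imp_has) (auto simp: map_le_def E_def)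
  \<comment> \<open>The free variables are carried along because they determine the environment when
    translating back.\<close>
  from assms(3) have "has Gen E N \<sigma> \<and> fv N = fv M"
  proof (induction rule: rtranclp_induct)
    case base
    from \<open>has Gen E M \<sigma>\<close> show ?case by simp
  next
    case (step P Q)
    then show ?case using has_beta fv_beta has_relevant by metis
  qed
  then show ?thesis using has_imp_typing[of Gen E N \<sigma>] \<Gamma> by simp
qed

end
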